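(* Let $\alpha,\beta$ be integers different from $1$ with $v_2(\alpha-1)=v_2(\beta-1)=m>1$, and suppose $\ell\ge 2m$, where $\ell=v_2(\alpha-\beta)$ (with $\ell=\infty$ if $\alpha=\beta$). Then $|G_2|=2^{7m-3}$, the nilpotency class of $G_2$ is $5$, $o(a)=o(b)=2^{3m-1}$ and $o(c)=2^{2m}$.
   Context: $G(\alpha,\beta)=\langle A,B\mid A^{[A,B]}=A^{\alpha},\ B^{[B,A]}=B^{\beta}\rangle$ with $[x,y]=x^{-1}y^{-1}xy$, $y^x=x^{-1}yx$, and $C=[A,B]$. The group $G(\alpha,\beta)$ is finite and nilpotent, hence the direct product of its Sylow subgroups; $G_2$ denotes its Sylow $2$-subgroup and $a,b,c$ denote the images of $A,B,C$ under the canonical projection $G(\alpha,\beta)\to G_2$. $v_2$ is the $2$-adic valuation and $o(x)$ the order of $x$. *)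

theory Defs
  imports "HOL-Algebra.Algebra" "HOL-Computational_Algebra.Primes" "HOL-Number_Theory.Cong"
begin

text \<open>Words in A, B and their inverses. A letter is (generator, inverted);
  generator False = A, True = B.\<close>
type_synonym gword = "(bool \<times> bool) list"

definition wA :: gword where "wA = [(False, False)]"
definition wAi :: gword where "wAi = [(False, True)]"
definition wB :: gword where "wB = [(True, False)]"
definition wBi :: gword where "wBi = [(True, True)]"

definition wpow :: "gword \<Rightarrow> gword \<Rightarrow> int \<Rightarrow> gword" where
  "wpow w winv k = (if 0 \<le> k then concat (replicate (nat k) w) else concat (replicate (nat (- k)) winv))"

definition wC :: gword where "wC = wAi @ wBi @ wA @ wB"
definition wCi :: gword where "wCi = wBi @ wAi @ wB @ wA"

inductive peq :: "int \<Rightarrow> int \<Rightarrow> gword \<Rightarrow> gword \<Rightarrow> bool" for \<alpha> \<beta> :: int where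
  refl: "peq \<alpha> \<beta> w w"
| sym: "peq \<alpha> \<beta> u v \<Longrightarrow> peq \<alpha> \<beta> v u"
| trans: "peq \<alpha> \<beta> u v \<Longrightarrow> peq \<alpha> \<beta> v w \<Longrightarrow> peq \<alpha> \<beta> u w"
| cancel: "peq \<alpha> \<beta> [x, (fst x, \<not> snd x)] []"
| rel1: "peq \<alpha> \<beta> (wCi @ wA @ wC) (wpow wA wAi \<alpha>)"
| rel2: "peq \<alpha> \<beta> (wC @ wB @ wCi) (wpow wB wBi \<beta>)"
| cong: "peq \<alpha> \<beta> u v \<Longrightarrow> peq \<alpha> \<beta> (p @ u @ q) (p @ v @ q)"

definition pclass :: "int \<Rightarrow> int \<Rightarrow> gword \<Rightarrow> gword set" where
  "pclass \<alpha> \<beta> w = {v. peq \<alpha> \<beta> w v}"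

text \<open>G(alpha,beta) = <A,B | A^[A,B] = A^alpha, B^[B,A] = B^beta> as the group of
  congruence classes of words.\<close>
definition Gpres :: "int \<Rightarrow> int \<Rightarrow> gword set monoid" where
  "Gpres \<alpha> \<beta> = \<lparr>carrier = range (pclass \<alpha> \<beta>),
     monoid.mult = (\<lambda>S T. {v. \<exists>x\<in>S. \<exists>y\<in>T. peq \<alpha> \<beta> (x @ y) v}),
     one = pclass \<alpha> \<beta> []\<rparr>"

definition sylow2 :: "('a, 'b) monoid_scheme \<Rightarrow> 'a set \<Rightarrow> bool" where
  "sylow2 G P \<longleftrightarrow> subgroup P G \<and> card P = 2 ^ multiplicity (2::nat) (order G)"

text \<open>The 2-component of an element x of finite order n = 2^k r (r odd): x^e with
  e = 1 mod 2^k and e = 0 mod r. In a finite nilpotent group this is the image of x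
  under the canonical projection onto the Sylow 2-subgroup.\<close>
definition two_part :: "('a, 'b) monoid_scheme \<Rightarrow> 'a \<Rightarrow> 'a" where
  "two_part G x = (let n = group.ord G x; k = multiplicity (2::nat) n in
     x [^]\<^bsub>G\<^esub> (SOME e::nat. [e = 1] (mod 2 ^ k) \<and> [e = 0] (mod (n div 2 ^ k))))"

definition gcomm :: "('a, 'b) monoid_scheme \<Rightarrow> 'a \<Rightarrow> 'a \<Rightarrow> 'a" where
  "gcomm G x y = inv\<^bsub>G\<^esub> x \<otimes>\<^bsub>G\<^esub> inv\<^bsub>G\<^esub> y \<otimes>\<^bsub>G\<^esub> x \<otimes>\<^bsub>G\<^esub> y"

definition comm_subgroup :: "('a, 'b) monoid_scheme \<Rightarrow> 'a set \<Rightarrow> 'a set \<Rightarrow> 'a set" where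
  "comm_subgroup G H K = generate G {gcomm G h k | h k. h \<in> H \<and> k \<in> K}"

text \<open>Lower central series of a subgroup P: lcs 0 = P (gamma_1), lcs (i+1) = [lcs i, P].\<close>
fun lcs :: "('a, 'b) monoid_scheme \<Rightarrow> 'a set \<Rightarrow> nat \<Rightarrow> 'a set" where
  "lcs G P 0 = P"
| "lcs G P (Suc i) = comm_subgroup G (lcs G P i) P"

definition nil_class :: "('a, 'b) monoid_scheme \<Rightarrow> 'a set \<Rightarrow> nat" where
  "nil_class G P = (LEAST c. lcs G P c = {\<one>\<^bsub>G\<^esub>})"

end

theory Submission
  imports Defs
begin

text \<open>
  Write \<open>q = 2\<^sup>m\<^sup>-\<^sup>1\<close> and \<open>C = [A, B]\<close>. Conjugating \<open>A\<^sup>n\<close> by \<open>B\<close> gives \<open>A\<^sup>n B = B C\<^sup>n A\<^sup>s\<close> with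
  \<open>s = \<alpha> + \<dots> + \<alpha>\<^sup>n\<close>, and symmetrically for \<open>B\<^sup>n A\<close>. Rewriting \<open>A C\<^sup>r B\<close> in two ways therefore yields a
  relation \<open>C\<^sup>t A\<^sup>y = B\<^sup>x\<close>. It makes nontrivial powers of \<open>A\<close> and \<open>B\<close> central and hence trivial, so that
  \<open>G = \<langle>B\<rangle>\<langle>C\<rangle>\<langle>A\<rangle>\<close> is finite. Once \<open>G\<close> is finite, \<open>\<alpha>\<close> and \<open>\<beta>\<close> may be taken positive and \<open>r = 1\<close>; then
  \<open>x\<close> and \<open>y\<close> are odd multiples of \<open>2q\<^sup>2\<close>, and counting along \<open>\<langle>A\<rangle> \<le> \<langle>C\<rangle>\<langle>A\<rangle> \<le> G\<close> shows that \<open>|G|\<close> divides an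
  odd multiple of \<open>16 q\<^sup>7 = 2\<^sup>7\<^sup>m\<^sup>-\<^sup>3\<close>.

  Conversely, left and right multiplication on normal forms \<open>B\<^sup>-\<^sup>i C\<^sup>j A\<^sup>k\<close> are given by explicit formulas
  on triples of exponents. They commute modulo a lattice of index \<open>16 q\<^sup>7\<close>, so the left multiplications
  generate a regular permutation group of that order which satisfies the defining relations. The
  map of \<open>G\<close> onto this group has a kernel of odd order, so it is injective on a Sylow
  2-subgroup, and orders and nilpotency class can be read off from the permutation group.
\<close>

subsection \<open>Geometric sums and dyadic congruences\<close>

definition geom_sum :: "'a::semiring_1 \<Rightarrow> nat \<Rightarrow> 'a" where
  "geom_sum x n = (\<Sum>i<n. x ^ i)"

lemma geom_sum_0 [simp]: "geom_sum x 0 = 0"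
  and geom_sum_1 [simp]: "geom_sum x (Suc 0) = 1"
  by (simp_all add: geom_sum_def)

lemma geom_sum_Suc: "geom_sum x (Suc n) = geom_sum x n + x ^ n"
  by (simp add: geom_sum_def)

lemma geom_sum_add: "geom_sum x (m + n) = geom_sum x m + x ^ m * geom_sum x n"
  by (induction n) (simp_all add: geom_sum_Suc distrib_left power_add mult.assoc add.assoc)

lemma geom_sum_Suc_shift: "geom_sum x (Suc n) = 1 + x * geom_sum x n"
  using geom_sum_add[of x 1 n] by simp

lemma of_nat_geom_sum: "of_nat (geom_sum x n) = geom_sum (of_nat x) n"
  by (simp add: geom_sum_def)

lemma power_eq_geom_sum:
  fixes x :: "'a::comm_ring_1"
  shows "x ^ n = 1 + (x - 1) * geom_sum x n"
  using power_diff_1_eq[of x n] by (simp add: geom_sum_def algebra_simps)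

lemma odd_geom_sum: "odd x \<Longrightarrow> odd n \<Longrightarrow> odd (geom_sum x n)" for x :: int
  by (simp add: geom_sum_def even_sum_iff)

lemma geom_sum_cong_of_nat:
  fixes x :: int
  assumes "[x = 1] (mod k)"
  shows "[geom_sum x n = int n] (mod k)"
proof -
  have "[geom_sum x n = (\<Sum>i<n. 1 ^ i)] (mod k)"
    unfolding geom_sum_def by (intro cong_sum cong_pow assms)
  then show ?thesis by simp
qed

lemma Suc_choose_two: "Suc n choose 2 = n + (n choose 2)"
  and Suc_choose_three: "Suc n choose 3 = (n choose 2) + (n choose 3)"
  by (simp_all add: numeral_2_eq_2 numeral_3_eq_3)

lemma power_one_plus_cong_cube:
  fixes u :: int
  shows "[(1 + u) ^ n = 1 + int n * u + int (n choose 2) * u\<^sup>2] (mod u ^ 3)"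
proof (induction n)
  case (Suc n)
  have "[(1 + u) ^ Suc n = (1 + u) * (1 + int n * u + int (n choose 2) * u\<^sup>2)] (mod u ^ 3)"
    (is "[_ = ?r] (mod _)")
    using cong_scalar_left[OF Suc] by simp
  also have "[?r = 1 + int (Suc n) * u + int (Suc n choose 2) * u\<^sup>2] (mod u ^ 3)"
    by (simp add: cong_iff_dvd_diff Suc_choose_two algebra_simps power2_eq_square power3_eq_cube)
  finally show ?case .
qed (simp add: binomial_eq_0)

lemma geom_sum_one_plus_cong_cube:
  fixes u :: int
  shows "[geom_sum (1 + u) n = int n + int (n choose 2) * u + int (n choose 3) * u\<^sup>2] (mod u ^ 3)"
proof (induction n)
  case (Suc n)
  have "[geom_sum (1 + u) (Suc n) = (int n + int (n choose 2) * u + int (n choose 3) * u\<^sup>2)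
      + (1 + int n * u + int (n choose 2) * u\<^sup>2)] (mod u ^ 3)"
    (is "[_ = ?r] (mod _)")
    unfolding geom_sum_Suc by (intro cong_add Suc power_one_plus_cong_cube)
  also have "?r = int (Suc n) + int (Suc n choose 2) * u + int (Suc n choose 3) * u\<^sup>2"
    by (simp add: Suc_choose_two Suc_choose_three algebra_simps)
  finally show ?case .
qed (simp add: binomial_eq_0)

lemma two_times_choose_two: "2 * int (n choose 2) = int n * (int n - 1)"
  by (induction n) (simp_all add: Suc_choose_two algebra_simps)

lemma three_times_choose_three: "3 * int (n choose 3) = (int n - 2) * int (n choose 2)"
proof (induction n)
  case (Suc n)
  then show ?case
    using two_times_choose_two[of n] by (simp add: Suc_choose_two Suc_choose_three algebra_simps)
qed (simp add: numeral_2_eq_2 numeral_3_eq_3)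

text \<open>For \<open>q = 2\<^sup>m\<^sup>-\<^sup>1\<close> the following locale says that \<open>x - 1\<close> has 2-adic valuation \<open>m\<close>.
  Writing the moduli \<open>2\<^sup>m\<close>, \<open>2\<^sup>2\<^sup>m\<^sup>-\<^sup>1\<close>, \<open>2\<^sup>3\<^sup>m\<^sup>-\<^sup>1\<close> as \<open>2q\<close>, \<open>2q\<^sup>2\<close>, \<open>4q\<^sup>3\<close> avoids truncated
  subtraction and makes the congruences polynomial identities.\<close>

locale dyadic_unit =
  fixes q x w :: int
  assumes coprime_3_q: "coprime 3 q" and x_eq: "x = 1 + 2 * q * w" and odd_w: "odd w"
begin

lemma q_nonzero: "q \<noteq> 0"
  using coprime_3_q by auto

lemma odd_x: "odd x"
  by (simp add: x_eq)

lemma cong_one: "[x = 1] (mod 2 * q)"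
  by (simp add: x_eq cong_iff_dvd_diff)

lemma cong_one_power: "[x ^ n = 1] (mod 2 * q)"
  using cong_pow[OF cong_one, of n] by simp

lemma x_power_mult_cong: "2 * q\<^sup>2 dvd d \<Longrightarrow> [x ^ n * d = d] (mod 4 * q ^ 3)"
proof -
  assume "2 * q\<^sup>2 dvd d"
  then have "(2 * q) * (2 * q\<^sup>2) dvd (x ^ n - 1) * d"
    using cong_one_power[of n] by (intro mult_dvd_mono) (simp_all add: cong_iff_dvd_diff)
  then show ?thesis
    by (simp add: cong_iff_dvd_diff algebra_simps power2_eq_square power3_eq_cube)
qed

lemma mult_minus_self_cong:
  assumes "[d = e] (mod 2 * q\<^sup>2)"
  shows "[x * d - d = x * e - e] (mod 4 * q ^ 3)"
  using x_power_mult_cong[of "d - e" 1] assms by (simp add: cong_iff_dvd_diff algebra_simps)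

lemma two_square_dvd_four_cube: "2 * q\<^sup>2 dvd 4 * q ^ 3"
  by (intro dvdI[of _ _ "2 * q"]) (simp add: power2_eq_square power3_eq_cube)

lemma dvd_choose_three:
  assumes "q dvd int (n choose 2)"
  shows "q dvd int (n choose 3)"
proof -
  have "q dvd 3 * int (n choose 3)"
    using assms by (simp add: three_times_choose_three)
  then show ?thesis
    using coprime_3_q by (simp add: coprime_dvd_mult_right_iff coprime_commute)
qed

lemma geom_sum_cong_cube:
  "[geom_sum x n = int n + int n * (int n - 1) * q * w + 4 * q\<^sup>2 * w\<^sup>2 * int (n choose 3)] (mod 4 * q ^ 3)"
proof -
  have "[geom_sum x n = int n + int (n choose 2) * (2 * q * w) + int (n choose 3) * (2 * q * w)\<^sup>2]
      (mod (2 * q * w) ^ 3)"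
    unfolding x_eq by (rule geom_sum_one_plus_cong_cube)
  moreover have "4 * q ^ 3 dvd (2 * q * w) ^ 3"
    by (simp add: power_mult_distrib mult.assoc mult_dvd_mono)
  moreover have "int n * (int n - 1) * q * w = int (n choose 2) * (2 * q * w)"
    using two_times_choose_two[of n] by (simp add: mult_ac)
  ultimately show ?thesis
    using cong_dvd_modulus by (fastforce simp: power_mult_distrib mult_ac)
qed

lemma geom_sum_cong_if_dvd:
  assumes "2 * q\<^sup>2 dvd int n"
  shows "[geom_sum x n = (1 + q) * int n] (mod 4 * q ^ 3)"
proof -
  obtain d where d: "int n = 2 * q\<^sup>2 * d" using assms by blast
  have "even ((int n - 1) * w - 1)"
    using odd_w by (simp add: d)
  then obtain e where e: "(int n - 1) * w = 1 + 2 * e" by (metis dvd_def diff_eq_eq add.commute)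
  have "2 * int (n choose 2) = 2 * (q * (q * d * (int n - 1)))"
    unfolding two_times_choose_two by (simp add: d power2_eq_square)
  then have "q dvd int (n choose 3)"
    by (intro dvd_choose_three) simp
  then have "4 * q ^ 3 dvd 4 * q\<^sup>2 * w\<^sup>2 * int (n choose 3)"
    by (auto simp: power2_eq_square power3_eq_cube)
  moreover have "int n * (int n - 1) * q * w = q * int n + 4 * q ^ 3 * (d * e)"
  proof -
    have "int n * (int n - 1) * q * w = int n * q * ((int n - 1) * w)" by simp
    then show ?thesis unfolding e by (simp add: d algebra_simps power2_eq_square power3_eq_cube)
  qed
  ultimately have "[int n + int n * (int n - 1) * q * w + 4 * q\<^sup>2 * w\<^sup>2 * int (n choose 3)
      = (1 + q) * int n] (mod 4 * q ^ 3)"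
    by (simp add: cong_iff_dvd_diff algebra_simps)
  with geom_sum_cong_cube show ?thesis by (rule cong_trans)
qed

lemma geom_sum_cong_square:
  assumes "2 * q dvd int n"
  shows "[geom_sum x n = int n] (mod 2 * q\<^sup>2)"
proof -
  have "2 * q * q dvd int n * ((int n - 1) * q * w)"
    using assms by (intro mult_dvd_mono) simp_all
  then have "[int n + int n * (int n - 1) * q * w + 4 * q\<^sup>2 * w\<^sup>2 * int (n choose 3) = int n] (mod 2 * q\<^sup>2)"
    by (simp add: cong_iff_dvd_diff power2_eq_square mult.assoc dvd_add)
  with cong_dvd_modulus[OF geom_sum_cong_cube two_square_dvd_four_cube]
  show ?thesis by (rule cong_trans)
qed

lemma power_minus_one_not_dvd:
  assumes "even q" and n: "int n = x - 1"
  shows "\<not> 4 * q ^ 3 dvd x ^ n - 1"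
proof
  have "2 * q dvd int n" by (simp add: n x_eq)
  then have "2 * q\<^sup>2 dvd geom_sum x n - int n"
    using geom_sum_cong_square by (simp add: cong_iff_dvd_diff)
  then obtain e where "geom_sum x n - int n = 2 * q\<^sup>2 * e" by blast
  then have e: "geom_sum x n = int n + 2 * q\<^sup>2 * e" by simp
  have "x ^ n - 1 = (4 * q\<^sup>2) * (w * (w + q * e))"
    unfolding power_eq_geom_sum[of x n] e n by (simp add: x_eq algebra_simps power2_eq_square)
  moreover assume "4 * q ^ 3 dvd x ^ n - 1"
  ultimately have "(4 * q\<^sup>2) * q dvd (4 * q\<^sup>2) * (w * (w + q * e))"
    by (simp add: power2_eq_square power3_eq_cube mult.assoc)
  then have "q dvd w * (w + q * e)" using q_nonzero by simp
  then have "even (w * (w + q * e))" using assms(1) by (rule dvd_trans[rotated])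
  then show False using odd_w assms(1) by simp
qed

lemma power_periodic:
  assumes "[int i = int j] (mod 2 * q\<^sup>2)"
  shows "[x ^ i = x ^ j] (mod 4 * q ^ 3)"
  using assms
proof (induction i j rule: linorder_wlog)
  case (le i j)
  define d where "d = j - i"
  have j: "j = i + d" using le(1) by (simp add: d_def)
  have d: "2 * q\<^sup>2 dvd int d" using le(2) by (simp add: j cong_iff_dvd_diff)
  then have "4 * q ^ 3 dvd 2 * q * w * ((1 + q) * int d)"
    by (auto simp: power2_eq_square power3_eq_cube)
  moreover have "[2 * q * w * geom_sum x d = 2 * q * w * ((1 + q) * int d)] (mod 4 * q ^ 3)"
    by (intro cong_scalar_left geom_sum_cong_if_dvd d)
  ultimately have "4 * q ^ 3 dvd 2 * q * w * geom_sum x d"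
    by (simp add: cong_dvd_iff)
  moreover have "x ^ i - x ^ j = - (x ^ i * (2 * q * w * geom_sum x d))"
    using power_eq_geom_sum[of x d] by (simp add: j power_add x_eq algebra_simps)
  ultimately show ?case by (simp add: cong_iff_dvd_diff)
next
  case (sym i j)
  then show ?case by (blast intro: cong_sym)
qed

lemma geom_sum_periodic:
  assumes "[int i = int j] (mod 2 * q\<^sup>2)"
  shows "[x * geom_sum x i - (1 + q) * int i = x * geom_sum x j - (1 + q) * int j] (mod 4 * q ^ 3)"
  using assms
proof (induction i j rule: linorder_wlog)
  case (le i j)
  define d where "d = j - i"
  have j: "j = i + d" using le(1) by (simp add: d_def)
  have d: "2 * q\<^sup>2 dvd int d" using le(2) by (simp add: j cong_iff_dvd_diff)
  have "[x ^ Suc i * geom_sum x d = x ^ Suc i * ((1 + q) * int d)] (mod 4 * q ^ 3)"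
    by (intro cong_scalar_left geom_sum_cong_if_dvd d)
  also have "[x ^ Suc i * ((1 + q) * int d) = (1 + q) * int d] (mod 4 * q ^ 3)"
    using d by (intro x_power_mult_cong) simp
  finally have "[x * geom_sum x i - (1 + q) * int j + x ^ Suc i * geom_sum x d
      = x * geom_sum x i - (1 + q) * int j + (1 + q) * int d] (mod 4 * q ^ 3)"
    (is "[?l = ?r] (mod _)") by (intro cong_add cong_refl)
  moreover have "?l = x * geom_sum x j - (1 + q) * int j" "?r = x * geom_sum x i - (1 + q) * int i"
    unfolding j geom_sum_add by (simp_all add: algebra_simps)
  ultimately show ?case by (metis cong_sym)
next
  case (sym i j)
  then show ?case by (blast intro: cong_sym)
qed

end

definition relator_exponent :: "int \<Rightarrow> nat \<Rightarrow> int" where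
  "relator_exponent x j = x * geom_sum x (nat (x ^ j)) - x ^ (j + nat (x ^ j))"

lemma six_times_choose_three: "6 * int (n choose 3) = int n * (int n - 1) * (int n - 2)"
proof -
  have "6 * int (n choose 3) = (int n - 2) * (2 * int (n choose 2))"
    using three_times_choose_three[of n] by simp
  then show ?thesis by (simp add: two_times_choose_two)
qed

lemma six_times_relator_exponent_cong:
  fixes t u :: int
  assumes t: "t = (1 + u) ^ j" and "0 \<le> t"
  shows "[6 * relator_exponent (1 + u) j
    = - 3 * t * (t - 1) * u + t * (t - 1) * (1 - 2 * t) * u\<^sup>2] (mod u ^ 3)"
proof -
  define s where "s = nat t"
  have s: "t = int s" using assms(2) by (simp add: s_def)
  have choose: "6 * int (s choose 2) = 3 * t * (t - 1)" "6 * int (s choose 3) = t * (t - 1) * (t - 2)"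
    using two_times_choose_two[of s] six_times_choose_three[of s] by (simp_all add: s)
  have "[6 * relator_exponent (1 + u) j
      = (1 + u) * (6 * (int s + int (s choose 2) * u + int (s choose 3) * u\<^sup>2))
        - t * (6 * (1 + int s * u + int (s choose 2) * u\<^sup>2))] (mod u ^ 3)"
    (is "[_ = ?r] (mod _)")
    unfolding relator_exponent_def t[symmetric] s_def[symmetric]
    unfolding power_add t[symmetric] right_diff_distrib mult.left_commute[of 6]
    by (intro cong_diff cong_scalar_left geom_sum_one_plus_cong_cube power_one_plus_cong_cube)
  also have "?r = - 3 * t * (t - 1) * u + t * (t - 1) * (1 - 2 * t) * u\<^sup>2
      + u ^ 3 * (t * (t - 1) * (t - 2))"
    (is "_ = ?e + _")
    unfolding distrib_left mult.assoc[symmetric] choose s[symmetric]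
    by (simp add: choose algebra_simps power2_eq_square power3_eq_cube)
  also have "[?e + u ^ 3 * (t * (t - 1) * (t - 2)) = ?e] (mod u ^ 3)"
    by (simp add: cong_iff_dvd_diff)
  finally show ?thesis .
qed

lemma relator_exponent_cong_cube:
  fixes u :: int
  assumes "0 \<le> (1 + u) ^ j"
  shows "[6 * relator_exponent (1 + u) j = - 3 * int j * u\<^sup>2] (mod u ^ 3)"
proof -
  define t where "t = (1 + u) ^ j"
  have "u\<^sup>2 dvd u ^ 3" by (simp add: le_imp_power_dvd)
  with power_one_plus_cong_cube[of u j]
  have "[t = 1 + int j * u + int (j choose 2) * u\<^sup>2] (mod u\<^sup>2)"
    unfolding t_def by (rule cong_dvd_modulus)
  also have "[1 + int j * u + int (j choose 2) * u\<^sup>2 = 1 + int j * u] (mod u\<^sup>2)"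
    by (simp add: cong_iff_dvd_diff)
  finally obtain l where l: "t = 1 + int j * u + u\<^sup>2 * l"
    by (metis cong_iff_lin cong_sym)
  define k where "k = int j + u * l"
  have tk: "t = 1 + u * k" and j: "int j = k - u * l"
    by (simp_all add: l k_def algebra_simps power2_eq_square)
  have "- 3 * t * (t - 1) * u + t * (t - 1) * (1 - 2 * t) * u\<^sup>2 - (- 3 * int j * u\<^sup>2)
      = u ^ 3 * (k * t * (1 - 2 * t) - 3 * (k\<^sup>2 + l))"
    unfolding j tk by (simp add: algebra_simps power2_eq_square power3_eq_cube)
  then have "[- 3 * t * (t - 1) * u + t * (t - 1) * (1 - 2 * t) * u\<^sup>2 = - 3 * int j * u\<^sup>2] (mod u ^ 3)"
    by (simp add: cong_iff_dvd_diff)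
  moreover have "0 \<le> t" using assms by (simp only: t_def)
  ultimately show ?thesis
    by (rule cong_trans[OF six_times_relator_exponent_cong[OF t_def], rotated])
qed

context dyadic_unit
begin

lemma relator_exponent_cong:
  assumes "0 \<le> x ^ j"
  shows "[relator_exponent x j = - 2 * q\<^sup>2 * int j * w\<^sup>2] (mod 4 * q ^ 3)"
proof -
  have "(2 * q * w) ^ 3 dvd 6 * relator_exponent x j + 3 * int j * (2 * q * w)\<^sup>2"
    using relator_exponent_cong_cube[of "2 * q * w" j] assms by (simp add: x_eq cong_iff_dvd_diff)
  then have "2 * (q ^ 3 * 4) dvd 2 * (3 * (relator_exponent x j + 2 * q\<^sup>2 * int j * w\<^sup>2))"
    by (auto simp: power_mult_distrib algebra_simps elim: dvd_mult_left)
  then have "q ^ 3 * 4 dvd 3 * (relator_exponent x j + 2 * q\<^sup>2 * int j * w\<^sup>2)"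
    unfolding dvd_mult_cancel_left by simp
  moreover have "coprime 3 (q ^ 3 * (2 * 2))"
    using coprime_3_q
    by (simp only: coprime_mult_right_iff coprime_power_right_iff coprime_right_2_iff_odd) simp
  ultimately have "q ^ 3 * 4 dvd relator_exponent x j + 2 * q\<^sup>2 * int j * w\<^sup>2"
    by (metis coprime_dvd_mult_right_iff coprime_commute mult_2 numeral_Bit0)
  then show ?thesis
    by (simp add: cong_iff_dvd_diff mult.commute)
qed

lemma relator_exponent_dvd:
  assumes "0 \<le> x ^ j"
  shows "2 * q\<^sup>2 dvd relator_exponent x j"
proof -
  have "[relator_exponent x j = - 2 * q\<^sup>2 * int j * w\<^sup>2] (mod 2 * q\<^sup>2)"
    by (rule cong_dvd_modulus[OF relator_exponent_cong[OF assms] two_square_dvd_four_cube])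
  then show ?thesis by (simp add: cong_dvd_iff)
qed

lemma relator_exponent_1:
  assumes "0 \<le> x"
  obtains y where "odd y" "relator_exponent x 1 = 2 * q\<^sup>2 * y"
proof -
  have "4 * q ^ 3 dvd relator_exponent x 1 + 2 * q\<^sup>2 * w\<^sup>2"
    using relator_exponent_cong[of 1] assms by (simp add: cong_iff_dvd_diff)
  then obtain k where "relator_exponent x 1 + 2 * q\<^sup>2 * w\<^sup>2 = 4 * q ^ 3 * k" by blast
  then have "relator_exponent x 1 = 2 * q\<^sup>2 * (2 * q * k - w\<^sup>2)"
    by (simp add: algebra_simps power2_eq_square power3_eq_cube)
  moreover have "odd (2 * q * k - w\<^sup>2)" using odd_w by simp
  ultimately show thesis by (rule that[rotated])
qed

lemma relator_exponent_shift:
  assumes "0 \<le> x ^ j" "[int i = int i' + x ^ j] (mod 4 * q ^ 3)"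
  shows "[x * geom_sum x i - x ^ (i + j) = x * geom_sum x i' + relator_exponent x j] (mod 4 * q ^ 3)"
proof -
  define s where "s = nat (x ^ j)"
  have s: "int s = x ^ j" using assms(1) by (simp add: s_def)
  have i: "[int i = int (i' + s)] (mod 4 * q ^ 3)" using assms(2) by (simp add: s)
  then have i_p: "[int i = int (i' + s)] (mod 2 * q\<^sup>2)"
    by (rule cong_dvd_modulus) (rule two_square_dvd_four_cube)
  have "[x * geom_sum x i = x * geom_sum x (i' + s)] (mod 4 * q ^ 3)"
    using cong_add[OF geom_sum_periodic[OF i_p] cong_scalar_left[OF i, of "1 + q"]] by simp
  moreover have "[x ^ i * x ^ j = x ^ (i' + s) * x ^ j] (mod 4 * q ^ 3)"
    by (intro cong_scalar_right power_periodic i_p)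
  ultimately have "[x * geom_sum x i - x ^ (i + j)
      = x * geom_sum x (i' + s) - x ^ (i' + s) * x ^ j] (mod 4 * q ^ 3)"
    unfolding power_add by (rule cong_diff)
  also have "x * geom_sum x (i' + s) - x ^ (i' + s) * x ^ j
      = x * geom_sum x i' + x ^ i' * relator_exponent x j"
    by (simp add: relator_exponent_def s_def[symmetric] geom_sum_add power_add algebra_simps)
  also have "[x * geom_sum x i' + x ^ i' * relator_exponent x j
      = x * geom_sum x i' + relator_exponent x j] (mod 4 * q ^ 3)"
    by (intro cong_add cong_refl x_power_mult_cong relator_exponent_dvd assms(1))
  finally show ?thesis .
qed

end

locale dyadic_unit_pair = \<alpha>: dyadic_unit q \<alpha> u + \<beta>: dyadic_unit q \<beta> v for q \<alpha> \<beta> u v +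
  assumes \<alpha>_cong_\<beta>: "[\<alpha> = \<beta>] (mod 4 * q\<^sup>2)"
begin

lemma pair_swap: "dyadic_unit_pair q \<beta> \<alpha> v u"
  using \<alpha>_cong_\<beta> by unfold_locales (rule cong_sym)

lemma relator_exponent_cong_pair:
  assumes "0 \<le> \<alpha> ^ j" "0 \<le> \<beta> ^ j"
  shows "[relator_exponent \<alpha> j = relator_exponent \<beta> j] (mod 4 * q ^ 3)"
proof -
  have "(2 * q) * (2 * q) dvd (2 * q) * (u - v)"
    using \<alpha>_cong_\<beta> by (simp add: \<alpha>.x_eq \<beta>.x_eq cong_iff_dvd_diff algebra_simps power2_eq_square)
  then have "2 * q dvd u - v"
    using \<alpha>.q_nonzero by (simp only: dvd_mult_cancel_left) simp
  then have "[u\<^sup>2 = v\<^sup>2] (mod 2 * q)"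
    by (intro cong_pow) (simp add: cong_iff_dvd_diff)
  then have "[(2 * q\<^sup>2) * u\<^sup>2 = (2 * q\<^sup>2) * v\<^sup>2] (mod (2 * q\<^sup>2) * (2 * q))"
    by (rule cong_cmult_leftI)
  moreover have "(2 * q\<^sup>2) * (2 * q) = 4 * q ^ 3"
    by (simp add: power2_eq_square power3_eq_cube)
  ultimately have "[- int j * ((2 * q\<^sup>2) * u\<^sup>2) = - int j * ((2 * q\<^sup>2) * v\<^sup>2)] (mod 4 * q ^ 3)"
    by (metis cong_scalar_left)
  then have "[- 2 * q\<^sup>2 * int j * u\<^sup>2 = - 2 * q\<^sup>2 * int j * v\<^sup>2] (mod 4 * q ^ 3)"
    by (simp add: mult_ac)
  then show ?thesis
    using \<alpha>.relator_exponent_cong[OF assms(1)] \<beta>.relator_exponent_cong[OF assms(2)]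
    by (blast intro: cong_trans cong_sym)
qed

end

subsection \<open>The Macdonald relations\<close>

context group
begin

lemma inv_mult_cancel_left: "x \<in> carrier G \<Longrightarrow> y \<in> carrier G \<Longrightarrow> inv x \<otimes> (x \<otimes> y) = y"
  by (simp flip: m_assoc)

lemma mult_inv_cancel_left: "x \<in> carrier G \<Longrightarrow> y \<in> carrier G \<Longrightarrow> x \<otimes> (inv x \<otimes> y) = y"
  by (simp flip: m_assoc)

lemma int_pow_mult_assoc:
  "x \<in> carrier G \<Longrightarrow> y \<in> carrier G \<Longrightarrow> x [^] (i::int) \<otimes> (x [^] j \<otimes> y) = x [^] (i + j) \<otimes> y"
  by (simp add: int_pow_mult m_assoc)

lemma int_pow_Suc: "x [^] int (Suc n) = x [^] int n \<otimes> x"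
  by (simp only: int_pow_int nat_pow_Suc)

lemma int_pow_commute_self:
  "x \<in> carrier G \<Longrightarrow> x [^] (i::int) \<otimes> x [^] (j::int) = x [^] j \<otimes> x [^] i"
  by (simp flip: int_pow_mult add: add.commute)

lemma int_pow_intertwine:
  assumes "x \<otimes> y = y \<otimes> z" and [simp]: "x \<in> carrier G" "y \<in> carrier G" "z \<in> carrier G"
  shows "x [^] (i::int) \<otimes> y = y \<otimes> z [^] i"
proof -
  have "(\<lambda>g. inv y \<otimes> (g \<otimes> y)) \<in> hom G G"
    by (rule homI) (simp_all add: m_assoc mult_inv_cancel_left)
  then have "inv y \<otimes> (x [^] i \<otimes> y) = (inv y \<otimes> (x \<otimes> y)) [^] i"
    by (intro hom_int_pow) simp_all
  then have "inv y \<otimes> (x [^] i \<otimes> y) = z [^] i"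
    by (simp add: assms(1) inv_mult_cancel_left)
  then show ?thesis
    by (metis assms(2,3) int_pow_closed m_closed mult_inv_cancel_left)
qed

lemma int_pow_commute:
  assumes "x \<otimes> y = y \<otimes> x" "x \<in> carrier G" "y \<in> carrier G"
  shows "x [^] (i::int) \<otimes> y = y \<otimes> x [^] i"
  using assms by (intro int_pow_intertwine)

lemma ord_nonzero_if_int_pow:
  assumes "x [^] (i::int) = \<one>" "i \<noteq> 0" "x \<in> carrier G"
  shows "ord x \<noteq> 0"
  using assms int_pow_eq_id[of x i] by auto

text \<open>Both sides are the commutator of \<open>x\<^sup>k\<close> and \<open>y\<^sup>j\<close>.\<close>

lemma int_pow_eq_if_powers_normalize:
  fixes j k p q :: int
  assumes x: "x \<otimes> y [^] j = y [^] j \<otimes> x [^] p" and y: "y \<otimes> x [^] k = x [^] k \<otimes> y [^] q"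
    and [simp]: "x \<in> carrier G" "y \<in> carrier G"
  shows "x [^] (k * (p - 1)) = y [^] (j * (1 - q))"
proof -
  have "y [^] j \<otimes> x [^] k \<otimes> x [^] (k * (p - 1)) = y [^] j \<otimes> x [^] (p * k)"
    by (simp add: m_assoc algebra_simps flip: int_pow_mult)
  also have "\<dots> = x [^] k \<otimes> y [^] j"
    using int_pow_intertwine[OF x, of k] by (simp add: int_pow_pow)
  also have "\<dots> = x [^] k \<otimes> y [^] (q * j) \<otimes> y [^] (j * (1 - q))"
    by (simp add: m_assoc algebra_simps flip: int_pow_mult)
  also have "\<dots> = y [^] j \<otimes> x [^] k \<otimes> y [^] (j * (1 - q))"
    using int_pow_intertwine[OF y, of j] by (simp add: int_pow_pow)
  finally show ?thesis by simp
qed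

end

locale macdonald = group G for G (structure) +
  fixes A B and \<alpha> \<beta> :: int
  assumes A_closed [simp]: "A \<in> carrier G" and B_closed [simp]: "B \<in> carrier G"
    and rel_A: "inv (gcomm G A B) \<otimes> A \<otimes> gcomm G A B = A [^] \<alpha>"
    and rel_B: "gcomm G A B \<otimes> B \<otimes> inv (gcomm G A B) = B [^] \<beta>"
begin

abbreviation C where "C \<equiv> gcomm G A B"

lemma C_closed [simp]: "C \<in> carrier G"
  by (simp add: gcomm_def)

lemma gcomm_swap: "gcomm G B A = inv C"
  by (simp add: gcomm_def inv_mult_group m_assoc)

lemma swap: "macdonald G B A \<beta> \<alpha>"
  using rel_A rel_B by unfold_locales (simp_all add: gcomm_swap)

lemma A_mult_C: "A \<otimes> C = C \<otimes> A [^] \<alpha>"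
  by (simp add: m_assoc mult_inv_cancel_left flip: rel_A)

lemma A_mult_B: "A \<otimes> B = B \<otimes> (A \<otimes> C)"
  by (simp add: gcomm_def m_assoc mult_inv_cancel_left)

lemma A_pow_mult_C_pow: "A [^] i \<otimes> C [^] int k = C [^] int k \<otimes> A [^] (i * \<alpha> ^ k)"
proof (induction k arbitrary: i)
  case (Suc k)
  have "A [^] i \<otimes> C [^] int (Suc k) = (A [^] i \<otimes> C [^] int k) \<otimes> C"
    by (simp only: int_pow_Suc) (simp add: m_assoc)
  also have "\<dots> = C [^] int k \<otimes> (A [^] (i * \<alpha> ^ k) \<otimes> C)"
    by (simp add: Suc m_assoc)
  also have "A [^] (i * \<alpha> ^ k) \<otimes> C = C \<otimes> A [^] (i * \<alpha> ^ Suc k)"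
    using int_pow_intertwine[OF A_mult_C, of "i * \<alpha> ^ k"] by (simp add: int_pow_pow mult_ac)
  also have "C [^] int k \<otimes> (C \<otimes> A [^] (i * \<alpha> ^ Suc k)) = C [^] int (Suc k) \<otimes> A [^] (i * \<alpha> ^ Suc k)"
    by (simp only: int_pow_Suc) (simp add: m_assoc)
  finally show ?case .
qed simp

lemma C_pow_mult_B_pow: "C [^] int k \<otimes> B [^] i = B [^] (i * \<beta> ^ k) \<otimes> C [^] int k"
proof -
  have "B [^] i \<otimes> inv (C [^] int k) = inv (C [^] int k) \<otimes> B [^] (i * \<beta> ^ k)"
    using macdonald.A_pow_mult_C_pow[OF swap, of i k] by (simp add: gcomm_swap int_pow_inv)
  then show ?thesis
    by (metis B_closed C_closed int_pow_closed inv_closed inv_solve_left inv_solve_right m_assoc m_closed)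
qed

lemma CA_pow: "(C [^] int t \<otimes> A [^] y) [^] int j = C [^] int (t * j) \<otimes> A [^] (y * geom_sum (\<alpha> ^ t) j)"
proof (induction j)
  case (Suc j)
  let ?W = "C [^] int t \<otimes> A [^] y"
  have "?W [^] int (Suc j) = ?W [^] int j \<otimes> ?W" by (rule int_pow_Suc)
  also have "\<dots> = C [^] int (t * j) \<otimes> ((A [^] (y * geom_sum (\<alpha> ^ t) j) \<otimes> C [^] int t) \<otimes> A [^] y)"
    by (simp add: Suc m_assoc)
  also have "\<dots> = C [^] int (t * Suc j) \<otimes> A [^] (y * geom_sum (\<alpha> ^ t) (Suc j))"
    by (simp add: A_pow_mult_C_pow m_assoc int_pow_mult_assoc flip: int_pow_mult)
      (simp add: geom_sum_Suc_shift algebra_simps)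
  finally show ?case .
qed simp

lemma A_pow_mult_B: "A [^] int n \<otimes> B = B \<otimes> (C [^] int n \<otimes> A [^] (\<alpha> * geom_sum \<alpha> n))"
  using int_pow_intertwine[OF A_mult_B, of "int n"] CA_pow[of 1 \<alpha> n]
  by (simp add: A_mult_C)

lemma B_pow_mult_A: "B [^] int n \<otimes> A = A \<otimes> (C [^] (- int n) \<otimes> B [^] (\<beta> * geom_sum \<beta> n))"
  using macdonald.A_pow_mult_B[OF swap, of n] by (simp add: gcomm_swap int_pow_inv int_pow_neg)

text \<open>Moving \<open>A\<close> and \<open>C\<^sup>r\<close> past each other and past \<open>B\<close> rewrites \<open>A C\<^sup>r B\<close> in two ways, because
  \<open>A C\<^sup>r = C\<^sup>r A\<^sup>n\<close> and \<open>C\<^sup>r B = B\<^sup>k C\<^sup>r\<close> for \<open>n = \<alpha>\<^sup>r\<close> and \<open>k = \<beta>\<^sup>r\<close>.\<close>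

lemma B_pow_mult_C_pow_eq:
  assumes n: "int n = \<alpha> ^ r" and k: "int k = \<beta> ^ r"
  shows "B [^] int k \<otimes> C [^] int r
    = C [^] (- int k) \<otimes> B [^] (\<beta> * geom_sum \<beta> k) \<otimes> (C [^] int (n + r) \<otimes> A [^] relator_exponent \<alpha> r)"
    (is "_ = _ \<otimes> ?W")
proof -
  have AC: "A \<otimes> C [^] int r = C [^] int r \<otimes> A [^] int n"
    using A_pow_mult_C_pow[of 1 r] n by simp
  have CB: "C [^] int r \<otimes> B = B [^] int k \<otimes> C [^] int r"
    using C_pow_mult_B_pow[of r 1] k by simp
  have W: "C [^] int (n + r) \<otimes> A [^] (\<alpha> * geom_sum \<alpha> n) = A \<otimes> ?W"
  proof -
    have "A \<otimes> ?W = (A \<otimes> C [^] int (n + r)) \<otimes> A [^] relator_exponent \<alpha> r"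
      by (simp add: m_assoc)
    also have "\<dots> = C [^] int (n + r) \<otimes> A [^] (\<alpha> ^ (n + r) + relator_exponent \<alpha> r)"
      using A_pow_mult_C_pow[of 1 "n + r"] by (simp add: m_assoc int_pow_mult)
    also have "\<alpha> ^ (n + r) + relator_exponent \<alpha> r = \<alpha> * geom_sum \<alpha> n"
      by (simp add: relator_exponent_def add.commute flip: n)
    finally show ?thesis by (simp only:)
  qed
  have "A \<otimes> (B [^] int k \<otimes> C [^] int r) = (A \<otimes> C [^] int r) \<otimes> B"
    by (simp add: m_assoc flip: CB)
  also have "\<dots> = C [^] int r \<otimes> (A [^] int n \<otimes> B)" by (simp add: AC m_assoc)
  also have "\<dots> = (C [^] int r \<otimes> B) \<otimes> (C [^] int n \<otimes> A [^] (\<alpha> * geom_sum \<alpha> n))"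
    by (simp add: A_pow_mult_B m_assoc)
  also have "\<dots> = B [^] int k \<otimes> (A \<otimes> ?W)"
    by (simp add: CB m_assoc int_pow_mult_assoc add.commute flip: W[unfolded of_nat_add])
  also have "\<dots> = A \<otimes> (C [^] (- int k) \<otimes> B [^] (\<beta> * geom_sum \<beta> k) \<otimes> ?W)"
    by (simp add: B_pow_mult_A m_assoc flip: m_assoc[of "B [^] int k" A])
  finally show ?thesis by simp
qed

lemma relator:
  assumes n: "int n = \<alpha> ^ r" and k: "int k = \<beta> ^ r"
  shows "B [^] (- relator_exponent \<beta> r) \<otimes> C [^] int (k + r)
    = C [^] int (n + r) \<otimes> A [^] relator_exponent \<alpha> r"
    (is "_ = ?W")
proof -
  let ?h = "\<beta> * geom_sum \<beta> k"
  have "B [^] ?h \<otimes> ?W = C [^] int k \<otimes> (B [^] int k \<otimes> C [^] int r)"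
    by (simp add: B_pow_mult_C_pow_eq[OF assms] m_assoc int_pow_mult_assoc)
  also have "\<dots> = (C [^] int k \<otimes> B [^] int k) \<otimes> C [^] int r"
    by (simp add: m_assoc)
  also have "\<dots> = B [^] (int k * \<beta> ^ k) \<otimes> C [^] int (k + r)"
    by (simp add: C_pow_mult_B_pow m_assoc int_pow_mult)
  also have "int k * \<beta> ^ k = ?h - relator_exponent \<beta> r"
    by (simp add: relator_exponent_def power_add flip: k)
  finally have "B [^] (- ?h) \<otimes> (B [^] ?h \<otimes> ?W)
      = B [^] (- ?h) \<otimes> (B [^] (?h - relator_exponent \<beta> r) \<otimes> C [^] int (k + r))"
    by simp
  then show ?thesis by (simp add: int_pow_mult_assoc)
qed

lemma relation_of_powers:
  assumes "odd \<alpha>" "odd \<beta>" and r: "0 \<le> \<beta> ^ r" "\<beta> ^ r \<le> \<alpha> ^ r"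
  obtains t and x y :: int where "\<alpha> ^ r - \<beta> ^ r dvd int t" "odd x" "odd y"
    "C [^] int t \<otimes> A [^] (relator_exponent \<alpha> r * y) = B [^] (relator_exponent \<beta> r * x)"
proof -
  define n k where "n = nat (\<alpha> ^ r)" and "k = nat (\<beta> ^ r)"
  have nk: "int n = \<alpha> ^ r" "int k = \<beta> ^ r" "k \<le> n" using r by (simp_all add: n_def k_def)
  define s where "s = k + r"
  define x where "x = - relator_exponent \<beta> r"
  define W where "W = C [^] int (n - k) \<otimes> A [^] relator_exponent \<alpha> r"
  define f where "f = nat (\<beta> ^ (2 * s))"
  have [simp]: "W \<in> carrier G" by (simp add: W_def)
  have f: "int f = \<beta> ^ (2 * s)" by (simp add: f_def)
  then have "odd f" using assms(2) by (metis even_of_nat even_power)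
  have W: "B [^] x \<otimes> C [^] int s = C [^] int s \<otimes> W"
    using relator[OF nk(1,2)] nk(3) by (simp add: s_def W_def x_def int_pow_mult_assoc add.commute)
  have "B [^] (x * \<beta> ^ s) \<otimes> C [^] int (2 * s) = (B [^] (x * \<beta> ^ s) \<otimes> C [^] int s) \<otimes> C [^] int s"
    by (simp add: m_assoc flip: int_pow_mult)
  also have "\<dots> = C [^] int s \<otimes> (C [^] int s \<otimes> W)"
    by (simp add: m_assoc W flip: C_pow_mult_B_pow)
  also have "\<dots> = C [^] int (2 * s) \<otimes> W" by (simp add: int_pow_mult_assoc)
  finally have "(B [^] (x * \<beta> ^ s)) [^] int f \<otimes> C [^] int (2 * s) = C [^] int (2 * s) \<otimes> W [^] int f"
    by (rule int_pow_intertwine) simp_all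
  then have "C [^] int (2 * s) \<otimes> B [^] (x * \<beta> ^ s) = C [^] int (2 * s) \<otimes> W [^] int f"
    by (simp only: C_pow_mult_B_pow int_pow_pow B_closed f)
  then have "W [^] int f = B [^] (x * \<beta> ^ s)" by simp
  moreover have "W [^] int f = C [^] int ((n - k) * f)
      \<otimes> A [^] (relator_exponent \<alpha> r * geom_sum (\<alpha> ^ (n - k)) f)"
    by (simp only: W_def CA_pow)
  moreover have "odd (geom_sum (\<alpha> ^ (n - k)) f)" using \<open>odd f\<close> assms(1) by (simp add: odd_geom_sum)
  moreover have "\<alpha> ^ r - \<beta> ^ r dvd int ((n - k) * f)" using nk by (simp add: of_nat_diff)
  ultimately show thesis
    using assms(2) by (intro that[of "(n - k) * f" "- (\<beta> ^ s)"]) (simp_all add: x_def)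
qed

lemma A_pow_commutes_C:
  fixes i :: int
  assumes "A [^] i \<otimes> B = B \<otimes> A [^] i"
  shows "A [^] i \<otimes> C = C \<otimes> A [^] i"
proof -
  have "A \<otimes> A [^] i = A [^] i \<otimes> A" "B \<otimes> A [^] i = A [^] i \<otimes> B"
    using int_pow_commute[of A A i] assms by simp_all
  then have inv: "A [^] i \<otimes> inv A = inv A \<otimes> A [^] i" "A [^] i \<otimes> inv B = inv B \<otimes> A [^] i"
    using int_pow_commute[of A "A [^] i" "-1"] int_pow_commute[of B "A [^] i" "-1"]
    by (simp_all add: int_pow_neg)
  have "A [^] i \<otimes> C = (A [^] i \<otimes> inv A) \<otimes> inv B \<otimes> A \<otimes> B" by (simp add: gcomm_def m_assoc)
  also have "\<dots> = inv A \<otimes> (A [^] i \<otimes> inv B) \<otimes> A \<otimes> B" by (simp add: inv m_assoc)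
  also have "\<dots> = inv A \<otimes> inv B \<otimes> (A [^] i \<otimes> A) \<otimes> B" by (simp add: inv m_assoc)
  also have "\<dots> = inv A \<otimes> inv B \<otimes> A \<otimes> (A [^] i \<otimes> B)" by (simp add: int_pow_commute[of A A] m_assoc)
  also have "\<dots> = C \<otimes> A [^] i" by (simp add: assms gcomm_def m_assoc)
  finally show ?thesis .
qed

lemma A_pow_eq_one_if_central:
  fixes i :: int
  assumes "A [^] i \<otimes> B = B \<otimes> A [^] i"
  shows "A [^] (i * (\<alpha> - 1)) = \<one>"
proof -
  have "C \<otimes> A [^] (i * \<alpha>) = C \<otimes> A [^] i"
    using A_pow_mult_C_pow[of i 1] A_pow_commutes_C[OF assms] by simp
  then have "A [^] (i * \<alpha>) = A [^] i" by simp
  then show ?thesis by (simp add: right_diff_distrib int_pow_diff)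
qed

lemma A_pow_central_if_B_pow:
  fixes i j :: int
  assumes "A [^] i = B [^] j"
  shows "A [^] i \<otimes> B = B \<otimes> A [^] i"
  unfolding assms by (rule int_pow_commute) simp_all

end

subsection \<open>Finiteness of the orders\<close>

lemma relator_exponent_nonzero:
  assumes "\<bar>x\<bar> > 1" "j > 0" "x ^ j > 0"
  shows "relator_exponent x j \<noteq> 0"
proof
  obtain n where n: "nat (x ^ j) = Suc n" using assms(3) by (metis gr0_conv_Suc zero_less_nat_eq)
  assume "relator_exponent x j = 0"
  then have "x = x ^ (j + Suc n) - x\<^sup>2 * geom_sum x n"
    by (simp add: relator_exponent_def n geom_sum_Suc_shift power2_eq_square algebra_simps)
  moreover have "x\<^sup>2 dvd x ^ (j + Suc n)" using assms(2) by (intro le_imp_power_dvd) simp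
  ultimately have "x * x dvd x * 1"
    by (metis dvd_diff dvd_triv_left mult.right_neutral power2_eq_square)
  then have "x dvd 1" using assms(1) by (subst (asm) dvd_mult_cancel_left) auto
  then show False using assms(1) by simp
qed

context macdonald
begin

lemma A_pow_eq_B_pow_if_relation:
  fixes x y :: int
  assumes rel: "C [^] int t \<otimes> A [^] y = B [^] x"
  shows "A [^] (y * (\<alpha> ^ t - 1)) = B [^] (x * (1 - \<beta> ^ t))"
proof (rule int_pow_eq_if_powers_normalize)
  let ?c = "C [^] int t"
  have AC: "A \<otimes> ?c = ?c \<otimes> A [^] (\<alpha> ^ t)" using A_pow_mult_C_pow[of 1 t] by simp
  have CB: "?c \<otimes> B = B [^] (\<beta> ^ t) \<otimes> ?c" using C_pow_mult_B_pow[of t 1] by simp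
  have "A \<otimes> B [^] x = ?c \<otimes> (A [^] (\<alpha> ^ t) \<otimes> A [^] y)"
    by (simp add: AC flip: rel m_assoc)
  then show "A \<otimes> B [^] x = B [^] x \<otimes> A [^] (\<alpha> ^ t)"
    by (simp add: int_pow_commute_self[of A "\<alpha> ^ t"] m_assoc flip: rel)
  have A_y: "A [^] y = inv ?c \<otimes> B [^] x" by (simp add: inv_mult_cancel_left flip: rel)
  have "B \<otimes> A [^] y = inv ?c \<otimes> ((?c \<otimes> B) \<otimes> inv ?c \<otimes> B [^] x)"
    by (simp add: A_y m_assoc inv_mult_cancel_left)
  also have "\<dots> = inv ?c \<otimes> (B [^] (\<beta> ^ t) \<otimes> B [^] x)"
    by (simp add: CB m_assoc mult_inv_cancel_left)
  also have "\<dots> = A [^] y \<otimes> B [^] (\<beta> ^ t)"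
    by (simp add: A_y m_assoc int_pow_commute_self[of B "\<beta> ^ t"])
  finally show "B \<otimes> A [^] y = A [^] y \<otimes> B [^] (\<beta> ^ t)" .
qed simp_all

lemma ord_nonzero_if_powers_eq:
  fixes i j :: int
  assumes "A [^] i = B [^] j" "i \<noteq> 0" "\<alpha> \<noteq> 1"
  shows "ord A \<noteq> 0"
proof (rule ord_nonzero_if_int_pow)
  show "A [^] (i * (\<alpha> - 1)) = \<one>"
    by (intro A_pow_eq_one_if_central A_pow_central_if_B_pow[OF assms(1)])
qed (use assms in simp_all)

lemma ord_nonzero_if_relation:
  fixes x y :: int
  assumes rel: "C [^] int t \<otimes> A [^] y = B [^] x" and "x \<noteq> 0" "y \<noteq> 0" "\<bar>\<alpha>\<bar> > 1" "\<bar>\<beta>\<bar> > 1"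
  shows "ord A \<noteq> 0" "ord B \<noteq> 0"
proof -
  obtain i j :: int where ij: "i \<noteq> 0" "j \<noteq> 0" "A [^] i = B [^] j"
  proof (cases "t = 0")
    case True
    then show thesis using assms by (intro that[of y x]) simp_all
  next
    case False
    have "z ^ t \<noteq> 1" if "\<bar>z\<bar> > 1" for z :: int
      using that False by (metis abs_1 one_less_power power_abs less_irrefl bot_nat_0.not_eq_extremum)
    then show thesis using assms A_pow_eq_B_pow_if_relation[OF rel]
      by (intro that[of "y * (\<alpha> ^ t - 1)" "x * (1 - \<beta> ^ t)"]) simp_all
  qed
  show "ord A \<noteq> 0"
    by (rule ord_nonzero_if_powers_eq[OF ij(3,1)]) (use assms in auto)
  show "ord B \<noteq> 0"
    by (rule macdonald.ord_nonzero_if_powers_eq[OF swap ij(3)[symmetric] ij(2)]) (use assms in auto)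
qed

lemma ord_nonzero_if_le:
  assumes "odd \<alpha>" "odd \<beta>" "\<bar>\<alpha>\<bar> > 1" "\<bar>\<beta>\<bar> > 1" "\<beta>\<^sup>2 \<le> \<alpha>\<^sup>2"
  shows "ord A \<noteq> 0" "ord B \<noteq> 0"
proof -
  have "relator_exponent z 2 \<noteq> 0" if "\<bar>z\<bar> > 1" for z
    using that by (intro relator_exponent_nonzero) auto
  then have "relator_exponent \<alpha> 2 \<noteq> 0" "relator_exponent \<beta> 2 \<noteq> 0"
    using assms by blast+
  moreover obtain t and x y :: int where "odd x" "odd y"
    "C [^] int t \<otimes> A [^] (relator_exponent \<alpha> 2 * y) = B [^] (relator_exponent \<beta> 2 * x)"
    using relation_of_powers[OF assms(1,2) _ assms(5)] by (metis zero_le_power2)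
  ultimately show "ord A \<noteq> 0" "ord B \<noteq> 0"
    using ord_nonzero_if_relation assms(3,4) by fastforce+
qed

lemma ord_nonzero:
  assumes "odd \<alpha>" "odd \<beta>" "\<bar>\<alpha>\<bar> > 1" "\<bar>\<beta>\<bar> > 1"
  shows "ord A \<noteq> 0" "ord B \<noteq> 0"
  using ord_nonzero_if_le[OF assms] macdonald.ord_nonzero_if_le[OF swap assms(2,1,4,3)]
  by (meson linear)+

end

subsection \<open>Normal forms\<close>

context group
begin

lemma pow_card_subgroup:
  assumes "subgroup H G" "x \<in> H"
  shows "x [^] card H = \<one>"
proof -
  interpret H: group "G\<lparr>carrier := H\<rparr>"
    using assms(1) by (rule subgroup.subgroup_is_group) (rule is_group)
  have "x [^]\<^bsub>G\<lparr>carrier := H\<rparr>\<^esub> order (G\<lparr>carrier := H\<rparr>) = \<one>\<^bsub>G\<lparr>carrier := H\<rparr>\<^esub>"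
    using assms(2) by (intro H.pow_order_eq_1) simp
  then show ?thesis by (simp add: order_def flip: nat_pow_consistent)
qed

lemma int_pow_eq_int_pow_nat:
  assumes "x \<in> carrier G" "ord x \<noteq> 0"
  obtains n where "x [^] (i::int) = x [^] int n"
proof
  have "int (ord x) dvd int (nat (i mod int (ord x))) - i"
    using assms(2) by (simp add: mod_eq_dvd_iff[symmetric])
  then show "x [^] i = x [^] int (nat (i mod int (ord x)))"
    using assms(1) by (simp only: int_pow_eq)
qed

lemma generate_subset_if_right_closed:
  assumes S: "finite S" "S \<subseteq> carrier G" "\<one> \<in> S" and "E \<subseteq> carrier G"
    and closed: "\<And>s g. s \<in> S \<Longrightarrow> g \<in> E \<Longrightarrow> s \<otimes> g \<in> S"
  shows "generate G E \<subseteq> S"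
proof
  have closed_inv: "s \<otimes> inv g \<in> S" if "s \<in> S" "g \<in> E" for s g
  proof -
    have g: "g \<in> carrier G" using that assms(4) by blast
    then have inj: "inj_on (\<lambda>s. s \<otimes> g) S" using S(2) by (intro inj_onI) (simp add: subset_iff)
    have "(\<lambda>s. s \<otimes> g) ` S \<subseteq> S" using closed that(2) by blast
    then have "(\<lambda>s. s \<otimes> g) ` S = S" using inj by (rule endo_inj_surj[OF S(1)])
    then have "s \<in> (\<lambda>s. s \<otimes> g) ` S" using that(1) by (simp only:)
    then obtain s' where "s' \<in> S" "s = s' \<otimes> g" by blast
    moreover from this have "s \<otimes> inv g = s'" using S(2) g by (auto simp: m_assoc)
    ultimately show ?thesis by simp
  qed
  fix h assume "h \<in> generate G E"
  then have "s \<otimes> h \<in> S" if "s \<in> S" for s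
    using that
  proof (induction arbitrary: s rule: generate.induct)
    case (eng h1 h2)
    then have "s \<otimes> h1 \<otimes> h2 \<in> S" by blast
    moreover have "h1 \<in> carrier G" "h2 \<in> carrier G" "s \<in> carrier G"
      using eng.hyps eng.prems generate_in_carrier[OF assms(4)] S(2) by blast+
    ultimately show ?case by (simp add: m_assoc)
  next
    case one
    then have "s \<in> carrier G" using S(2) by blast
    then show ?case using one by simp
  qed (use closed closed_inv in blast)+
  then have "\<one> \<otimes> h \<in> S" using S(3) by blast
  moreover have "h \<in> carrier G" using \<open>h \<in> generate G E\<close> generate_in_carrier[OF assms(4)] by blast
  ultimately show "h \<in> S" by simp
qed

lemma set_mult_memI: "h \<in> H \<Longrightarrow> k \<in> K \<Longrightarrow> h \<otimes> k \<in> H <#> K"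
  by (auto simp: set_mult_def)

lemma card_mult_fiber:
  assumes "subgroup H G" "subgroup K G" "h \<in> H" "k \<in> K"
  shows "card {(h', k') \<in> H \<times> K. h' \<otimes> k' = h \<otimes> k} = card (H \<inter> K)"
proof -
  interpret H: subgroup H G by fact
  interpret K: subgroup K G by fact
  let ?f = "\<lambda>x. (h \<otimes> x, inv x \<otimes> k)"
  have "{(h', k') \<in> H \<times> K. h' \<otimes> k' = h \<otimes> k} = ?f ` (H \<inter> K)"
  proof (intro subset_antisym subsetI)
    fix p assume "p \<in> {(h', k') \<in> H \<times> K. h' \<otimes> k' = h \<otimes> k}"
    then obtain h' k' where p: "p = (h', k')" "h' \<in> H" "k' \<in> K" "h' \<otimes> k' = h \<otimes> k" by blast
    define x where "x = inv h \<otimes> h'"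
    have "h' = h \<otimes> k \<otimes> inv k'"
      using p assms(3,4) by (metis H.mem_carrier K.mem_carrier inv_solve_right m_closed)
    then have "x = k \<otimes> inv k'"
      using p assms(3,4) by (simp add: x_def m_assoc inv_mult_cancel_left)
    moreover have "x \<in> H" using p assms(3) by (simp add: x_def)
    ultimately have "x \<in> H \<inter> K" using p assms(4) by simp
    moreover have "p = ?f x"
      using p assms(3,4)
      by (simp add: x_def inv_mult_group m_assoc mult_inv_cancel_left inv_mult_cancel_left flip: p(4))
    ultimately show "p \<in> ?f ` (H \<inter> K)" by blast
  next
    fix p assume "p \<in> ?f ` (H \<inter> K)"
    then show "p \<in> {(h', k') \<in> H \<times> K. h' \<otimes> k' = h \<otimes> k}"
      using assms(3,4) by (auto simp: m_assoc mult_inv_cancel_left)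
  qed
  moreover have "inj_on ?f (H \<inter> K)" using assms(3) by (auto intro!: inj_onI)
  ultimately show ?thesis by (simp add: card_image)
qed

lemma card_set_mult_Int:
  assumes H: "subgroup H G" "finite H" and K: "subgroup K G" "finite K"
  shows "card (H <#> K) * card (H \<inter> K) = card H * card K"
proof -
  let ?f = "\<lambda>(h, k). h \<otimes> k"
  have image: "?f ` (H \<times> K) = H <#> K" by (auto simp: set_mult_def)
  have fiber: "card {p \<in> H \<times> K. ?f p = g} = card (H \<inter> K)" if "g \<in> H <#> K" for g
  proof -
    obtain h k where g: "g = h \<otimes> k" "h \<in> H" "k \<in> K" using \<open>g \<in> _\<close> by (auto simp: set_mult_def)
    have "{p \<in> H \<times> K. ?f p = g} = {(h', k') \<in> H \<times> K. h' \<otimes> k' = h \<otimes> k}" by (auto simp: g(1))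
    then show ?thesis using card_mult_fiber[OF H(1) K(1) g(2,3)] by simp
  qed
  have "card (H \<times> K) = (\<Sum>g\<in>?f ` (H \<times> K). \<Sum>p | p \<in> H \<times> K \<and> ?f p = g. 1)"
    unfolding card_eq_sum using H(2) K(2) by (intro sum.image_gen) simp
  also have "\<dots> = card (H <#> K) * card (H \<inter> K)"
    using fiber by (simp add: image)
  finally show ?thesis by (simp add: card_cartesian_product)
qed

lemma card_generate_set_mult_dvd:
  assumes b: "b \<in> carrier G" "ord b \<noteq> 0" and H: "subgroup H G" "finite H" "b [^] (n::int) \<in> H"
  shows "int (card (generate G {b} <#> H)) dvd n * int (card H)" "finite (generate G {b} <#> H)"
proof -
  let ?K = "generate G {b}"
  have K: "subgroup ?K G" using b by (simp add: generate_is_subgroup)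
  have card_K: "card ?K = ord b" using generate_pow_card[OF b(1)] by simp
  then have "finite ?K" using b(2) by (metis card.infinite)
  then show "finite (?K <#> H)" using H(2) by (simp add: set_mult_def)
  have KH: "subgroup (?K \<inter> H) G" using K H(1) by (rule subgroups_Inter_pair)
  then have pos: "card (?K \<inter> H) > 0"
    using H(2) subgroup.one_closed by (fastforce simp: card_gt_0_iff)
  have "b [^] n \<in> ?K \<inter> H" using H(3) generate_pow[OF b(1)] by blast
  then have "(b [^] n) [^] int (card (?K \<inter> H)) = \<one>"
    using pow_card_subgroup[OF KH] by (simp only: int_pow_int)
  then have "int (ord b) dvd n * int (card (?K \<inter> H))"
    using b(1) by (simp add: int_pow_pow int_pow_eq_id)
  then have "int (ord b * card H) dvd n * int (card (?K \<inter> H)) * int (card H)"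
    by (simp add: mult_dvd_mono)
  then have "int (card (?K <#> H)) * int (card (?K \<inter> H)) dvd n * int (card H) * int (card (?K \<inter> H))"
    using card_set_mult_Int[OF K \<open>finite ?K\<close> H(1,2)] by (simp add: card_K mult_ac flip: of_nat_mult)
  then show "int (card (?K <#> H)) dvd n * int (card H)"
    using pos by simp
qed

end

locale torsion_macdonald = macdonald +
  assumes generated: "carrier G = generate G {A, B}" and ord_A: "ord A \<noteq> 0" and ord_B: "ord B \<noteq> 0"
begin

lemma torsion_swap: "torsion_macdonald G B A \<beta> \<alpha>"
proof -
  have "carrier G = generate G {B, A}" by (simp only: generated insert_commute)
  then show ?thesis
    by (intro torsion_macdonald.intro swap torsion_macdonald_axioms.intro ord_A ord_B)
qed

lemma ord_C: "ord C \<noteq> 0"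
proof (rule ord_nonzero_if_int_pow)
  have "A [^] int (ord A) = \<one>" by (simp add: int_pow_int)
  then have "B = B \<otimes> (C [^] int (ord A) \<otimes> A [^] (\<alpha> * geom_sum \<alpha> (ord A)))"
    using A_pow_mult_B[of "ord A"] by simp
  then have "C [^] int (ord A) \<otimes> A [^] (\<alpha> * geom_sum \<alpha> (ord A)) = \<one>"
    by simp
  then have "C [^] int (ord A) = A [^] (- (\<alpha> * geom_sum \<alpha> (ord A)))"
    by (simp add: int_pow_neg inv_equality)
  then have "(C [^] int (ord A)) [^] int (ord A) = \<one>"
    by (simp add: int_pow_pow int_pow_eq_id)
  then show "C [^] (int (ord A) * int (ord A)) = \<one>" by (simp add: int_pow_pow)
qed (use ord_A in simp_all)

definition CA_coset :: "int \<Rightarrow> 'a set" where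
  "CA_coset j = {C [^] j \<otimes> A [^] i | i::int. True}"

lemma CA_cosetI: "C [^] j \<otimes> A [^] (i::int) \<in> CA_coset j"
  by (auto simp: CA_coset_def)

lemma A_pow_in_CA_coset: "A [^] (i::int) \<in> CA_coset 0"
  using CA_cosetI[of 0 i] by simp

lemma C_pow_in_CA_coset: "C [^] j \<in> CA_coset j"
  using CA_cosetI[of j 0] by simp

lemma CA_coset_carrier: "CA_coset j \<subseteq> carrier G"
  by (auto simp: CA_coset_def)

lemma A_pow_mult_C_int_pow: "\<exists>i'. A [^] (i::int) \<otimes> C [^] (j::int) = C [^] j \<otimes> A [^] (i'::int)"
proof -
  obtain n where "C [^] j = C [^] int n" using int_pow_eq_int_pow_nat[OF C_closed ord_C] .
  then show ?thesis using A_pow_mult_C_pow[of i n] by auto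
qed

lemma CA_coset_mult:
  assumes "g \<in> CA_coset j" "h \<in> CA_coset k"
  shows "g \<otimes> h \<in> CA_coset (j + k)"
proof -
  obtain i l :: int where gh: "g = C [^] j \<otimes> A [^] i" "h = C [^] k \<otimes> A [^] l"
    using assms by (auto simp: CA_coset_def)
  obtain i' :: int where i': "A [^] i \<otimes> C [^] k = C [^] k \<otimes> A [^] i'" using A_pow_mult_C_int_pow by blast
  have "g \<otimes> h = C [^] j \<otimes> ((A [^] i \<otimes> C [^] k) \<otimes> A [^] l)" by (simp add: gh m_assoc)
  also have "\<dots> = C [^] (j + k) \<otimes> A [^] (i' + l)" by (simp add: i' m_assoc int_pow_mult)
  finally show ?thesis by (simp add: CA_cosetI)
qed

lemma CA_coset_inv:
  assumes "g \<in> CA_coset j"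
  shows "inv g \<in> CA_coset (- j)"
proof -
  obtain i :: int where "g = C [^] j \<otimes> A [^] i" using assms by (auto simp: CA_coset_def)
  then have "inv g = A [^] (- i) \<otimes> C [^] (- j)" by (simp add: inv_mult_group int_pow_neg)
  then show ?thesis using CA_coset_mult[OF A_pow_in_CA_coset C_pow_in_CA_coset] by simp
qed

lemma CA_coset_int_pow:
  assumes "g \<in> CA_coset j"
  shows "g [^] (e::int) \<in> CA_coset (j * e)"
proof -
  have nat: "g [^] int n \<in> CA_coset (j * int n)" for n
  proof (induction n)
    case (Suc n)
    then have "g [^] int n \<otimes> g \<in> CA_coset (j * int n + j)"
      using assms by (rule CA_coset_mult)
    then show ?case by (simp only: int_pow_Suc) (simp add: algebra_simps)
  qed (use A_pow_in_CA_coset[of 0] in simp)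
  have "g \<in> carrier G" using assms CA_coset_carrier by blast
  then show ?thesis
    using nat CA_coset_inv[OF nat] by (cases e rule: int_cases2) (simp_all add: int_pow_neg)
qed

lemma C_pow_diff_in_CA_coset:
  assumes "g \<in> CA_coset j" "g \<in> CA_coset k"
  shows "C [^] (j - k) \<in> CA_coset 0"
proof -
  obtain i :: int where i: "g = C [^] j \<otimes> A [^] i" using assms(1) by (auto simp: CA_coset_def)
  obtain l :: int where l: "g = C [^] k \<otimes> A [^] l" using assms(2) by (auto simp: CA_coset_def)
  have "C [^] (j - k) = C [^] (- k) \<otimes> ((C [^] j \<otimes> A [^] i) \<otimes> A [^] (- i))"
    by (simp add: m_assoc flip: int_pow_mult)
  also have "\<dots> = C [^] (- k) \<otimes> ((C [^] k \<otimes> A [^] l) \<otimes> A [^] (- i))"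
    using i l by simp
  also have "\<dots> = A [^] (l - i)"
    by (simp add: m_assoc int_pow_mult_assoc flip: int_pow_mult)
  finally show ?thesis by (simp only: A_pow_in_CA_coset)
qed

definition CA_subgroup :: "'a set" where "CA_subgroup = (\<Union>j. CA_coset j)"

lemma subgroup_CA: "subgroup CA_subgroup G"
proof
  show "CA_subgroup \<subseteq> carrier G" using CA_coset_carrier by (auto simp: CA_subgroup_def)
  show "\<one> \<in> CA_subgroup" using A_pow_in_CA_coset[of 0] by (auto simp: CA_subgroup_def)
qed (auto simp: CA_subgroup_def intro: CA_coset_mult CA_coset_inv)

lemma CA_coset_0: "CA_coset 0 = generate G {A}"
  by (auto simp: CA_coset_def generate_pow)

lemma CA_subgroup_eq: "CA_subgroup = generate G {C} <#> generate G {A}"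
  by (auto simp: CA_subgroup_def CA_coset_def set_mult_def generate_pow)

lemma finite_CA_subgroup: "finite CA_subgroup"
  and card_CA_subgroup_dvd: "C [^] (c::int) \<in> CA_coset 0 \<Longrightarrow> int (card CA_subgroup) dvd c * int (ord A)"
proof -
  have "card (generate G {A}) = ord A" using generate_pow_card[OF A_closed] by simp
  moreover from this have "finite (generate G {A})" using ord_A by (metis card.infinite)
  moreover have "subgroup (generate G {A}) G" by (simp add: generate_is_subgroup)
  ultimately show "finite CA_subgroup"
      "C [^] (c::int) \<in> CA_coset 0 \<Longrightarrow> int (card CA_subgroup) dvd c * int (ord A)"
    using card_generate_set_mult_dvd[OF C_closed ord_C] int_pow_0
    unfolding CA_subgroup_eq CA_coset_0 by (metis subgroup.one_closed, metis)
qed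

lemma A_pow_mult_B_coset:
  obtains g where "g \<in> CA_coset i" "A [^] (i::int) \<otimes> B = B \<otimes> g"
proof
  have "A \<otimes> C \<in> CA_coset 1" using CA_cosetI[of 1 \<alpha>] by (simp add: A_mult_C)
  then show "(A \<otimes> C) [^] i \<in> CA_coset i" using CA_coset_int_pow by fastforce
  show "A [^] i \<otimes> B = B \<otimes> (A \<otimes> C) [^] i" using A_mult_B by (rule int_pow_intertwine) simp_all
qed

lemma CA_subgroup_mult_B:
  assumes "h \<in> CA_subgroup"
  shows "h \<otimes> B \<in> generate G {B} <#> CA_subgroup"
proof -
  obtain i j :: int where h: "h = C [^] j \<otimes> A [^] i"
    using assms by (auto simp: CA_subgroup_def CA_coset_def)
  obtain g where g: "g \<in> CA_coset i" "A [^] i \<otimes> B = B \<otimes> g" by (rule A_pow_mult_B_coset)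
  obtain l where l: "C [^] j = C [^] int l" using int_pow_eq_int_pow_nat[OF C_closed ord_C] .
  have [simp]: "g \<in> carrier G" using g(1) CA_coset_carrier by blast
  have "h \<otimes> B = (C [^] int l \<otimes> B) \<otimes> g"
    by (simp add: h l g(2) m_assoc)
  also have "\<dots> = B [^] (\<beta> ^ l) \<otimes> (C [^] int l \<otimes> g)"
    using C_pow_mult_B_pow[of l 1] by (simp add: m_assoc)
  finally have "h \<otimes> B = B [^] (\<beta> ^ l) \<otimes> (C [^] int l \<otimes> g)" .
  moreover have "B [^] (\<beta> ^ l) \<in> generate G {B}" by (auto simp: generate_pow)
  moreover have "C [^] int l \<otimes> g \<in> CA_subgroup"
    unfolding CA_subgroup_def using g(1) by (blast intro: CA_coset_mult C_pow_in_CA_coset)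
  ultimately show ?thesis by (simp only: set_mult_memI)
qed

lemma finite_B_CA: "finite (generate G {B} <#> CA_subgroup)"
proof -
  have "B [^] (0::int) \<in> CA_subgroup" using subgroup.one_closed[OF subgroup_CA] by simp
  then show ?thesis
    by (rule card_generate_set_mult_dvd(2)[OF B_closed ord_B subgroup_CA finite_CA_subgroup])
qed

lemma carrier_eq: "carrier G = generate G {B} <#> CA_subgroup"
proof
  interpret CA: subgroup CA_subgroup G by (rule subgroup_CA)
  interpret K: subgroup "generate G {B}" G by (simp add: generate_is_subgroup)
  show sub: "generate G {B} <#> CA_subgroup \<subseteq> carrier G" by (auto simp: set_mult_def)
  have "generate G {A, B} \<subseteq> generate G {B} <#> CA_subgroup"
  proof (rule generate_subset_if_right_closed[OF finite_B_CA sub])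
    show "\<one> \<in> generate G {B} <#> CA_subgroup"
      using set_mult_memI[OF K.one_closed CA.one_closed] by simp
    fix g x assume "g \<in> generate G {B} <#> CA_subgroup" and x: "x \<in> {A, B}"
    then obtain b h where g: "g = b \<otimes> h" "b \<in> generate G {B}" "h \<in> CA_subgroup"
      by (auto simp: set_mult_def)
    have "A \<in> CA_subgroup" using A_pow_in_CA_coset[of 1] by (auto simp: CA_subgroup_def)
    then have "\<one> \<otimes> (h \<otimes> A) \<in> generate G {B} <#> CA_subgroup"
      using g by (intro set_mult_memI K.one_closed CA.m_closed)
    then have "h \<otimes> x \<in> generate G {B} <#> CA_subgroup"
      using x g CA_subgroup_mult_B by auto
    then obtain b' h' where "h \<otimes> x = b' \<otimes> h'" "b' \<in> generate G {B}" "h' \<in> CA_subgroup"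
      by (auto simp: set_mult_def)
    moreover from this have "g \<otimes> x = (b \<otimes> b') \<otimes> h'" using g x by (auto simp: m_assoc)
    ultimately show "g \<otimes> x \<in> generate G {B} <#> CA_subgroup"
      using g by (simp add: set_mult_memI)
  qed simp
  then show "carrier G \<subseteq> generate G {B} <#> CA_subgroup" by (simp only: generated)
qed

lemma finite_carrier: "finite (carrier G)"
  unfolding carrier_eq by (rule finite_B_CA)

lemma order_dvd:
  assumes "A [^] (a::int) = \<one>" "C [^] (c::int) \<in> CA_coset 0" "B [^] (b::int) \<in> CA_subgroup"
  shows "int (order G) dvd a * c * b"
proof -
  have "int (order G) dvd b * int (card CA_subgroup)"
    unfolding order_def carrier_eq
    by (rule card_generate_set_mult_dvd(1)[OF B_closed ord_B subgroup_CA finite_CA_subgroup assms(3)])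
  also have "\<dots> dvd b * (c * int (ord A))"
    by (intro mult_dvd_mono dvd_refl card_CA_subgroup_dvd assms(2))
  also have "\<dots> dvd b * (c * a)"
    using assms(1) by (intro mult_dvd_mono dvd_refl) (simp_all add: int_pow_eq_id)
  finally show ?thesis by (simp add: mult_ac)
qed

end

subsection \<open>A bound for the order\<close>

lemma (in group) int_pow_dvd_in_subgroup:
  assumes "subgroup H G" "x [^] (d::int) \<in> H" "d dvd e" "x \<in> carrier G"
  shows "x [^] e \<in> H"
proof -
  obtain k where "e = d * k" using assms(3) by blast
  then have "x [^] e = (x [^] d) [^] k" using assms(4) by (simp add: int_pow_pow)
  then show ?thesis using subgroup_int_pow_closed[OF assms(1,2)] by simp
qed

locale dyadic_macdonald = torsion_macdonald G A B \<alpha> \<beta> + \<alpha>: dyadic_unit q \<alpha> u + \<beta>: dyadic_unit q \<beta> v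
  for G (structure) and A B \<alpha> \<beta> q u v +
  fixes t :: nat and x y :: int
  assumes relation: "C [^] int t \<otimes> A [^] (2 * q\<^sup>2 * y) = B [^] (2 * q\<^sup>2 * x)"
    and dvd_t: "4 * q\<^sup>2 dvd int t" and odd_x: "odd x" and odd_y: "odd y"
begin

lemma dyadic_swap: "dyadic_macdonald G B A \<beta> \<alpha> q v u t y x"
proof -
  have "inv C [^] int t \<otimes> B [^] (2 * q\<^sup>2 * x) = A [^] (2 * q\<^sup>2 * y)"
    by (simp add: inv_mult_cancel_left int_pow_inv flip: relation)
  then show ?thesis
    by (intro dyadic_macdonald.intro dyadic_macdonald_axioms.intro torsion_swap dvd_t odd_x odd_y
        \<alpha>.dyadic_unit_axioms \<beta>.dyadic_unit_axioms) (simp add: gcomm_swap)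
qed

lemma C_pow_in_A_powers:
  obtains c where "odd c" "C [^] (2 * q\<^sup>2 * c) \<in> generate G {A}"
proof -
  let ?p = "2 * q\<^sup>2"
  obtain s where s: "int t = 4 * q\<^sup>2 * s" using dvd_t by blast
  have "[\<beta> ^ t = \<beta> ^ 0] (mod 4 * q ^ 3)"
    by (rule \<beta>.power_periodic) (simp add: cong_iff_dvd_diff s)
  then have "?p dvd \<beta> ^ t - 1"
    using dvd_trans[OF \<beta>.two_square_dvd_four_cube] by (simp add: cong_iff_dvd_diff)
  then obtain e where e: "\<beta> ^ t - 1 = ?p * e" by blast
  obtain g where g: "g \<in> CA_coset (?p * y)" "A [^] (?p * y) \<otimes> B = B \<otimes> g"
    by (rule A_pow_mult_B_coset)
  have [simp]: "g \<in> carrier G" using g(1) CA_coset_carrier by blast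
  have "B [^] (?p * x + 1) = C [^] int t \<otimes> (A [^] (?p * y) \<otimes> B)"
    by (simp add: int_pow_mult m_assoc flip: relation)
  also have "\<dots> = B [^] (\<beta> ^ t) \<otimes> (C [^] int t \<otimes> g)"
    using C_pow_mult_B_pow[of t 1] by (simp add: g(2) flip: m_assoc)
  finally have "B [^] (- (\<beta> ^ t)) \<otimes> B [^] (?p * x + 1) = C [^] int t \<otimes> g"
    by (simp add: int_pow_mult_assoc)
  moreover have "- (\<beta> ^ t) + (?p * x + 1) = ?p * (x - e)" using e by (simp add: algebra_simps)
  ultimately have "B [^] (?p * (x - e)) \<in> CA_coset (int t + ?p * y)"
    using CA_coset_mult[OF C_pow_in_CA_coset g(1)] by (simp flip: int_pow_mult)
  then have "(B [^] (?p * (x - e))) [^] x \<in> CA_coset ((int t + ?p * y) * x)"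
    by (rule CA_coset_int_pow)
  moreover have "(B [^] (?p * x)) [^] (x - e) \<in> CA_coset (int t * (x - e))"
    unfolding relation[symmetric] by (intro CA_coset_int_pow CA_cosetI)
  ultimately have "C [^] ((int t + ?p * y) * x - int t * (x - e)) \<in> CA_coset 0"
    by (intro C_pow_diff_in_CA_coset) (simp_all add: int_pow_pow mult_ac)
  moreover have "(int t + ?p * y) * x - int t * (x - e) = ?p * (y * x + 2 * s * e)"
    by (simp add: s algebra_simps)
  moreover have "odd (y * x + 2 * s * e)" using odd_x odd_y by simp
  ultimately show thesis by (intro that) (simp_all only: CA_coset_0 not_False_eq_True)
qed

lemma C_pow_in_B_powers:
  obtains c where "odd c" "C [^] (2 * q\<^sup>2 * c) \<in> generate G {B}"
proof -
  obtain c where c: "odd c" "inv C [^] (2 * q\<^sup>2 * c) \<in> generate G {B}"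
    using dyadic_macdonald.C_pow_in_A_powers[OF dyadic_swap] unfolding gcomm_swap by blast
  then have "C [^] (2 * q\<^sup>2 * - c) \<in> generate G {B}" by (simp add: int_pow_inv int_pow_neg)
  then show thesis using c(1) by (intro that[of "- c"]) simp_all
qed

lemma A_pow_eq_one:
  obtains a where "odd a" "A [^] (4 * q ^ 3 * a) = \<one>"
proof -
  obtain c where c: "odd c" "C [^] (2 * q\<^sup>2 * c) \<in> generate G {B}" by (rule C_pow_in_B_powers)
  define j where "j = nat \<bar>c\<bar>"
  have j: "int j = \<bar>c\<bar>" by (simp add: j_def)
  define z where "z = 2 * q\<^sup>2 * y * geom_sum (\<alpha> ^ t) j"
  interpret K: subgroup "generate G {B}" G by (simp add: generate_is_subgroup)
  have "2 * q\<^sup>2 dvd int t" using dvd_t by (elim dvd_trans[rotated]) simp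
  then have "2 * q\<^sup>2 * c dvd int (t * j)"
    unfolding of_nat_mult j by (rule mult_dvd_mono) simp
  then have C: "C [^] int (t * j) \<in> generate G {B}"
    by (rule int_pow_dvd_in_subgroup[OF K.subgroup_axioms c(2) _ C_closed])
  have "C [^] int (t * j) \<otimes> A [^] z = B [^] (2 * q\<^sup>2 * x * int j)"
    using CA_pow[of t "2 * q\<^sup>2 * y" j] by (simp only: z_def relation int_pow_pow B_closed)
  then have "A [^] z = inv (C [^] int (t * j)) \<otimes> B [^] (2 * q\<^sup>2 * x * int j)"
    by (metis A_closed C_closed int_pow_closed inv_mult_cancel_left)
  moreover have "B [^] (2 * q\<^sup>2 * x * int j) \<in> generate G {B}" by (auto simp: generate_pow)
  ultimately have "A [^] z \<in> generate G {B}" using C by simp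
  then obtain k :: int where "A [^] z = B [^] k" by (auto simp: generate_pow)
  then have "A [^] (z * (\<alpha> - 1)) = \<one>"
    by (intro A_pow_eq_one_if_central A_pow_central_if_B_pow)
  moreover have "z * (\<alpha> - 1) = 4 * q ^ 3 * (y * geom_sum (\<alpha> ^ t) j * u)"
    by (simp add: z_def \<alpha>.x_eq power2_eq_square power3_eq_cube)
  moreover have "odd (y * geom_sum (\<alpha> ^ t) j * u)"
    using c(1) odd_y \<alpha>.odd_w \<alpha>.odd_x j odd_geom_sum[of "\<alpha> ^ t" j] by (simp add: j_def even_nat_iff)
  ultimately show thesis by (intro that) (simp_all only: not_False_eq_True)
qed

lemma order_dvd_odd_multiple: "\<exists>c. odd c \<and> int (order G) dvd 16 * q ^ 7 * c"
proof -
  obtain a where a: "odd a" "A [^] (4 * q ^ 3 * a) = \<one>" by (rule A_pow_eq_one)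
  obtain c where c: "odd c" "C [^] (2 * q\<^sup>2 * c) \<in> CA_coset 0"
    using C_pow_in_A_powers by (auto simp: CA_coset_0)
  have "B [^] (2 * q\<^sup>2 * x) \<in> CA_subgroup"
    unfolding relation[symmetric] CA_subgroup_def by (blast intro: CA_cosetI)
  then have "int (order G) dvd (4 * q ^ 3 * a) * (2 * q\<^sup>2 * c) * (2 * q\<^sup>2 * x)"
    using a(2) c(2) by (intro order_dvd)
  also have "\<dots> = 16 * q ^ 7 * (a * c * x)" by (simp add: power_numeral_reduce)
  finally show ?thesis using a(1) c(1) odd_x by (intro exI[of _ "a * c * x"]) simp
qed

end

lemma (in torsion_macdonald) order_dvd_odd_multiple_if_nonneg:
  assumes "dyadic_unit_pair q \<alpha> \<beta> u v" and "0 \<le> \<beta>" "\<beta> \<le> \<alpha>"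
  shows "\<exists>c. odd c \<and> int (order G) dvd 16 * q ^ 7 * c"
proof -
  interpret dyadic_unit_pair q \<alpha> \<beta> u v by fact
  obtain y' where y': "odd y'" "relator_exponent \<alpha> 1 = 2 * q\<^sup>2 * y'"
    using \<alpha>.relator_exponent_1 assms(2,3) by (metis order_trans)
  obtain x' where x': "odd x'" "relator_exponent \<beta> 1 = 2 * q\<^sup>2 * x'"
    using \<beta>.relator_exponent_1 assms(2) by blast
  obtain t and x y :: int where t: "\<alpha> ^ 1 - \<beta> ^ 1 dvd int t" and "odd x" "odd y"
    and rel: "C [^] int t \<otimes> A [^] (relator_exponent \<alpha> 1 * y) = B [^] (relator_exponent \<beta> 1 * x)"
    using relation_of_powers[of 1, OF \<alpha>.odd_x \<beta>.odd_x] assms(2,3) by auto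
  have "4 * q\<^sup>2 dvd int t"
    using t \<alpha>_cong_\<beta> by (auto simp: cong_iff_dvd_diff elim: dvd_trans)
  then interpret dyadic_macdonald G A B \<alpha> \<beta> q u v t "x' * x" "y' * y"
    using \<open>odd x\<close> \<open>odd y\<close> x' y' rel by unfold_locales (simp_all add: mult.assoc)
  show ?thesis by (rule order_dvd_odd_multiple)
qed

subsection \<open>Central series\<close>

declare lcs.simps(2) [simp del]

context group
begin

lemma gcomm_closed [simp]: "x \<in> carrier G \<Longrightarrow> y \<in> carrier G \<Longrightarrow> gcomm G x y \<in> carrier G"
  by (simp add: gcomm_def)

lemma gcomm_one_left [simp]: "x \<in> carrier G \<Longrightarrow> gcomm G \<one> x = \<one>"
  and gcomm_one_right [simp]: "x \<in> carrier G \<Longrightarrow> gcomm G x \<one> = \<one>"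
  by (simp_all add: gcomm_def)

lemma gcomm_eq_one_if_commute:
  assumes "x \<otimes> y = y \<otimes> x" "x \<in> carrier G" "y \<in> carrier G"
  shows "gcomm G x y = \<one>"
  using assms by (simp add: gcomm_def m_assoc inv_mult_cancel_left)

lemma inv_gcomm: "x \<in> carrier G \<Longrightarrow> y \<in> carrier G \<Longrightarrow> inv (gcomm G x y) = gcomm G y x"
  by (simp add: gcomm_def inv_mult_group m_assoc)

lemma gcomm_mult_right:
  "x \<in> carrier G \<Longrightarrow> g \<in> carrier G \<Longrightarrow> h \<in> carrier G \<Longrightarrow>
    gcomm G x (g \<otimes> h) = gcomm G x h \<otimes> (inv h \<otimes> gcomm G x g \<otimes> h)"
  by (simp add: gcomm_def inv_mult_group m_assoc mult_inv_cancel_left)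

lemma gcomm_inv_right:
  "x \<in> carrier G \<Longrightarrow> g \<in> carrier G \<Longrightarrow> gcomm G x (inv g) = g \<otimes> gcomm G g x \<otimes> inv g"
  by (simp add: gcomm_def m_assoc mult_inv_cancel_left)

lemma gcomm_in_normal_swap:
  assumes "N \<lhd> G" "x \<in> carrier G" "y \<in> carrier G" "gcomm G x y \<in> N"
  shows "gcomm G y x \<in> N"
  using subgroup.m_inv_closed[OF normal_imp_subgroup[OF assms(1)] assms(4)] assms(2,3)
  by (simp add: inv_gcomm)

lemma subgroup_commuting_mod_normal:
  assumes "N \<lhd> G" and x: "x \<in> carrier G"
  shows "subgroup {g \<in> carrier G. gcomm G x g \<in> N} G"
proof -
  interpret N: normal N G by fact
  show ?thesis
  proof
    fix g assume "g \<in> {g \<in> carrier G. gcomm G x g \<in> N}"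
    then show "inv g \<in> {g \<in> carrier G. gcomm G x g \<in> N}"
      using x gcomm_in_normal_swap[OF assms(1) x] by (simp add: gcomm_inv_right N.inv_op_closed2)
  qed (use x in \<open>auto simp: gcomm_mult_right N.inv_op_closed1\<close>)
qed

fun upper_central :: "nat \<Rightarrow> 'a set" where
  "upper_central 0 = {\<one>}"
| "upper_central (Suc n) = {x \<in> carrier G. \<forall>g\<in>carrier G. gcomm G x g \<in> upper_central n}"

lemma upper_central_carrier: "upper_central n \<subseteq> carrier G"
  by (cases n) auto

lemma normal_subset_upper_central_Suc:
  assumes "upper_central n \<lhd> G"
  shows "upper_central n \<subseteq> upper_central (Suc n)"
proof
  interpret N: normal "upper_central n" G by fact
  fix x assume x: "x \<in> upper_central n"
  have "gcomm G x g \<in> upper_central n" if "g \<in> carrier G" for g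
  proof -
    have "gcomm G x g = inv x \<otimes> (inv g \<otimes> x \<otimes> g)"
      using x that by (simp add: gcomm_def m_assoc)
    then show ?thesis using x that by (simp add: N.inv_op_closed1)
  qed
  then show "x \<in> upper_central (Suc n)" using x by simp
qed

lemma normal_upper_central: "upper_central n \<lhd> G"
proof (induction n)
  case 0
  show ?case by (simp add: one_is_normal)
next
  case (Suc n)
  have "upper_central (Suc n) = (\<Inter>g\<in>carrier G. {x \<in> carrier G. gcomm G x g \<in> upper_central n})"
    using one_closed by auto
  also have "\<dots> = (\<Inter>g\<in>carrier G. {x \<in> carrier G. gcomm G g x \<in> upper_central n})"
    by (intro INF_cong Collect_cong conj_cong HOL.refl) (rule iffI; rule gcomm_in_normal_swap[OF Suc])
  finally have "upper_central (Suc n) = (\<Inter>g\<in>carrier G. {x \<in> carrier G. gcomm G g x \<in> upper_central n})" .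
  moreover have "subgroup (\<Inter>g\<in>carrier G. {x \<in> carrier G. gcomm G g x \<in> upper_central n}) G"
    using subgroup_commuting_mod_normal[OF Suc] one_closed by (intro subgroups_Inter) blast+
  ultimately have sub: "subgroup (upper_central (Suc n)) G" by (simp only:)
  have "g \<otimes> x \<otimes> inv g \<in> upper_central (Suc n)"
    if x: "x \<in> upper_central (Suc n)" and g: "g \<in> carrier G" for x g
  proof -
    have "gcomm G x (inv g) \<in> upper_central n" using x g by simp
    then have "gcomm G x (inv g) \<in> upper_central (Suc n)"
      by (rule subsetD[OF normal_subset_upper_central_Suc[OF Suc]])
    moreover have "g \<otimes> x \<otimes> inv g = x \<otimes> gcomm G x (inv g)"
      using subgroup.mem_carrier[OF sub x] g by (simp add: gcomm_def m_assoc mult_inv_cancel_left)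
    ultimately show ?thesis using subgroup.m_closed[OF sub x] by (simp only:)
  qed
  then show ?case unfolding normal_inv_iff using sub by blast
qed

lemma subgroup_upper_central: "subgroup (upper_central n) G"
  by (intro normal_imp_subgroup normal_upper_central)

lemma upper_central_mono: "m \<le> n \<Longrightarrow> upper_central m \<subseteq> upper_central n"
  by (rule lift_Suc_mono_le) (intro normal_subset_upper_central_Suc normal_upper_central)

lemma upper_central_SucI:
  assumes "carrier G = generate G E" "E \<subseteq> carrier G" "x \<in> carrier G"
    and "\<And>g. g \<in> E \<Longrightarrow> gcomm G x g \<in> upper_central n"
  shows "x \<in> upper_central (Suc n)"
proof -
  have "E \<subseteq> {g \<in> carrier G. gcomm G x g \<in> upper_central n}" using assms(2,4) by blast
  then have "generate G E \<subseteq> {g \<in> carrier G. gcomm G x g \<in> upper_central n}"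
    by (rule generate_subgroup_incl) (intro subgroup_commuting_mod_normal normal_upper_central assms(3))
  then show ?thesis using assms(1,3) by auto
qed

lemma lcs_subgroup:
  assumes "subgroup P G"
  shows "subgroup (lcs G P i) G \<and> lcs G P i \<subseteq> P"
proof (induction i)
  case (Suc i)
  interpret P: subgroup P G by fact
  have comm: "{gcomm G h k | h k. h \<in> lcs G P i \<and> k \<in> P} \<subseteq> P"
    using Suc by (auto simp: gcomm_def)
  then have "generate G {gcomm G h k | h k. h \<in> lcs G P i \<and> k \<in> P} \<subseteq> P"
    using assms by (rule generate_subgroup_incl)
  moreover have "subgroup (generate G {gcomm G h k | h k. h \<in> lcs G P i \<and> k \<in> P}) G"
    using comm P.subset by (intro generate_is_subgroup) blast
  ultimately show ?case by (simp add: lcs.simps(2) comm_subgroup_def)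
qed (use assms in simp)

lemma gcomm_in_lcs: "h \<in> lcs G P i \<Longrightarrow> k \<in> P \<Longrightarrow> gcomm G h k \<in> lcs G P (Suc i)"
  by (auto simp: lcs.simps(2) comm_subgroup_def intro: generate.incl)

lemma lcs_Suc_trivial:
  assumes "subgroup P G" "lcs G P i = {\<one>}"
  shows "lcs G P (Suc i) = {\<one>}"
proof -
  have "{gcomm G h k | h k. h \<in> {\<one>} \<and> k \<in> P} = {\<one>}"
    using subgroup.one_closed[OF assms(1)] subgroup.mem_carrier[OF assms(1)] by force
  then show ?thesis by (simp add: lcs.simps(2) comm_subgroup_def assms(2) generate_one)
qed

lemma lcs_subset_upper_central:
  assumes "upper_central n = carrier G" "i \<le> n"
  shows "lcs G (carrier G) i \<subseteq> upper_central (n - i)"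
  using assms(2)
proof (induction i)
  case (Suc i)
  then have "n - i = Suc (n - Suc i)" by simp
  then have "{gcomm G h k | h k. h \<in> lcs G (carrier G) i \<and> k \<in> carrier G} \<subseteq> upper_central (n - Suc i)"
    using Suc by fastforce
  then show ?case
    using generate_subgroup_incl[OF _ subgroup_upper_central] by (simp add: lcs.simps(2) comm_subgroup_def)
qed (use assms(1) in simp)

lemma lcs_trivial_if_upper_central:
  assumes "upper_central n = carrier G"
  shows "lcs G (carrier G) n = {\<one>}"
  using lcs_subset_upper_central[OF assms, of n] lcs_subgroup[OF subgroup_self, of n]
    subgroup.one_closed by fastforce

lemma nil_class_eqI:
  assumes P: "subgroup P G" "lcs G P (Suc c) = {\<one>}" "lcs G P c \<noteq> {\<one>}"
  shows "nil_class G P = Suc c"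
  unfolding nil_class_def
proof (rule Least_equality)
  fix d assume d: "lcs G P d = {\<one>}"
  show "Suc c \<le> d"
  proof (rule ccontr)
    assume "\<not> Suc c \<le> d"
    then have "d \<le> c" by simp
    then have "lcs G P c = {\<one>}"
      by (induction rule: dec_induct) (use d lcs_Suc_trivial[OF P(1)] in auto)
    then show False using P(3) by blast
  qed
qed (rule P(2))

end

context group_hom
begin

lemma hom_gcomm: "x \<in> carrier G \<Longrightarrow> y \<in> carrier G \<Longrightarrow> h (gcomm G x y) = gcomm H (h x) (h y)"
  by (simp add: gcomm_def)

lemma lcs_image:
  assumes P: "subgroup P G"
  shows "lcs H (h ` P) i = h ` lcs G P i"
proof (induction i)
  case (Suc i)
  interpret P: subgroup P G by fact
  have lcs_carrier: "lcs G P i \<subseteq> carrier G" using G.lcs_subgroup[OF P] P.subset by blast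
  let ?E = "{gcomm G x k | x k. x \<in> lcs G P i \<and> k \<in> P}"
  have "{gcomm H x k | x k. x \<in> h ` lcs G P i \<and> k \<in> h ` P} = h ` ?E"
  proof -
    have "h (gcomm G x k) = gcomm H (h x) (h k)" if "x \<in> lcs G P i" "k \<in> P" for x k
      using that lcs_carrier P.subset by (intro hom_gcomm) auto
    then show ?thesis by (auto simp: image_iff) metis+
  qed
  moreover have "?E \<subseteq> carrier G" using lcs_carrier P.subset by auto
  ultimately show ?case using generate_img[of ?E] by (simp add: lcs.simps(2) comm_subgroup_def Suc)
qed simp

lemma nil_class_image:
  assumes P: "subgroup P G" and inj: "inj_on h P"
  shows "nil_class H (h ` P) = nil_class G P"
proof -
  have "h ` lcs G P i = {\<one>\<^bsub>H\<^esub>} \<longleftrightarrow> lcs G P i = {\<one>}" for i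
  proof -
    have "lcs G P i \<subseteq> P" "{\<one>} \<subseteq> P"
      using G.lcs_subgroup[OF P, of i] subgroup.one_closed[OF P] by simp_all
    then have "h ` lcs G P i = h ` {\<one>} \<longleftrightarrow> lcs G P i = {\<one>}"
      using inj by (intro inj_on_image_eq_iff)
    then show ?thesis by simp
  qed
  then show ?thesis by (simp add: nil_class_def lcs_image[OF P])
qed

end

context macdonald
begin

lemma gcomm_CA_A: "gcomm G (C [^] int n \<otimes> A [^] (i::int)) A = A [^] (1 - \<alpha> ^ n)"
proof -
  have "gcomm G (C [^] int n \<otimes> A [^] i) A
      = A [^] (- i) \<otimes> (inv (A \<otimes> C [^] int n) \<otimes> (C [^] int n \<otimes> A [^] (i + 1)))"
    by (simp add: gcomm_def inv_mult_group m_assoc int_pow_neg int_pow_mult)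
  also have "\<dots> = A [^] (- i) \<otimes> (A [^] (- (\<alpha> ^ n)) \<otimes> A [^] (i + 1))"
    using A_pow_mult_C_pow[of 1 n] by (simp add: inv_mult_group m_assoc inv_mult_cancel_left int_pow_neg)
  also have "\<dots> = A [^] (- i + (- (\<alpha> ^ n) + (i + 1)))" by (simp only: int_pow_mult A_closed)
  finally show ?thesis by simp
qed

lemma gcomm_C_pow_B: "gcomm G (C [^] int n) B = inv (C [^] int n) \<otimes> B [^] (\<beta> ^ n - 1) \<otimes> C [^] int n"
proof -
  have "gcomm G (C [^] int n) B = inv (C [^] int n) \<otimes> (B [^] (- 1::int) \<otimes> (C [^] int n \<otimes> B))"
    by (simp add: gcomm_def m_assoc int_pow_neg)
  also have "C [^] int n \<otimes> B = B [^] (\<beta> ^ n) \<otimes> C [^] int n"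
    using C_pow_mult_B_pow[of n 1] by simp
  finally show ?thesis by (simp add: int_pow_mult_assoc m_assoc)
qed

lemma gcomm_A_pow_B:
  "gcomm G (A [^] int n) B = C [^] int n \<otimes> A [^] (\<alpha> * geom_sum \<alpha> n - int n * \<alpha> ^ n)"
proof -
  have "gcomm G (A [^] int n) B = A [^] (- int n) \<otimes> (inv B \<otimes> (A [^] int n \<otimes> B))"
    by (simp add: gcomm_def m_assoc int_pow_neg)
  also have "\<dots> = (A [^] (- int n) \<otimes> C [^] int n) \<otimes> A [^] (\<alpha> * geom_sum \<alpha> n)"
    by (simp add: A_pow_mult_B inv_mult_cancel_left m_assoc)
  also have "\<dots> = C [^] int n \<otimes> A [^] (\<alpha> * geom_sum \<alpha> n - int n * \<alpha> ^ n)"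
    by (simp add: A_pow_mult_C_pow m_assoc flip: int_pow_mult)
  finally show ?thesis .
qed

lemma A_pow_in_lcs_4:
  assumes n: "int n = \<alpha> - 1"
  shows "A [^] (1 - \<alpha> ^ n) \<in> lcs G (carrier G) 4"
proof -
  let ?\<gamma> = "lcs G (carrier G)"
  have gcomm: "gcomm G g h \<in> ?\<gamma> (i + 1)" if "g \<in> ?\<gamma> i" "h \<in> carrier G" for g h i
    using gcomm_in_lcs[OF that] by simp
  have "gcomm G C A \<in> ?\<gamma> (0 + 1 + 1)" by (intro gcomm) simp_all
  then have "inv (gcomm G C A) \<in> ?\<gamma> (0 + 1 + 1)"
    using lcs_subgroup[OF subgroup_self] by (blast intro: subgroup.m_inv_closed)
  moreover have "inv (gcomm G C A) = A [^] int n"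
    using gcomm_CA_A[of 1 0] by (simp add: n flip: int_pow_neg)
  ultimately have "A [^] int n \<in> ?\<gamma> (0 + 1 + 1)" by (simp only:)
  then have "gcomm G (gcomm G (A [^] int n) B) A \<in> ?\<gamma> (0 + 1 + 1 + 1 + 1)" by (intro gcomm) simp_all
  moreover have "gcomm G (gcomm G (A [^] int n) B) A = A [^] (1 - \<alpha> ^ n)"
    by (simp add: gcomm_A_pow_B gcomm_CA_A)
  ultimately show ?thesis by (simp add: numeral_eq_Suc)
qed

end

locale central_macdonald = macdonald G A B \<alpha> \<beta> + \<alpha>: dyadic_unit "int q" \<alpha> u + \<beta>: dyadic_unit "int q" \<beta> v
  for G (structure) and A B \<alpha> \<beta> and q :: nat and u v +
  assumes generated: "carrier G = generate G {A, B}"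
    and A_pow_commutes_B: "A [^] (2 * (int q)\<^sup>2) \<otimes> B = B \<otimes> A [^] (2 * (int q)\<^sup>2)"
    and B_pow_commutes_A: "B [^] (2 * (int q)\<^sup>2) \<otimes> A = A \<otimes> B [^] (2 * (int q)\<^sup>2)"
begin

lemma central_swap: "central_macdonald G B A \<beta> \<alpha> q v u"
proof -
  have "carrier G = generate G {B, A}" by (simp only: generated insert_commute)
  then show ?thesis
    by (intro central_macdonald.intro swap central_macdonald_axioms.intro
        A_pow_commutes_B B_pow_commutes_A \<alpha>.dyadic_unit_axioms \<beta>.dyadic_unit_axioms)
qed

lemma upper_centralI:
  assumes "x \<in> carrier G" "gcomm G x A \<in> upper_central n" "gcomm G x B \<in> upper_central n"
  shows "x \<in> upper_central (Suc n)"
  by (rule upper_central_SucI[OF generated _ assms(1)]) (use assms(2,3) in auto)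

lemma A_pow_in_upper_central_1:
  assumes "2 * (int q)\<^sup>2 dvd i"
  shows "A [^] (i::int) \<in> upper_central 1"
proof (rule int_pow_dvd_in_subgroup[OF subgroup_upper_central _ assms A_closed])
  have "A [^] (2 * (int q)\<^sup>2) \<in> upper_central (Suc 0)"
    by (intro upper_centralI) (simp_all add: gcomm_eq_one_if_commute A_pow_commutes_B int_pow_commute)
  then show "A [^] (2 * (int q)\<^sup>2) \<in> upper_central 1" by (simp only: One_nat_def)
qed

lemma C_pow_in_upper_central:
  assumes "l = Suc k" "A [^] (1 - \<alpha> ^ n) \<in> upper_central k" "B [^] (\<beta> ^ n - 1) \<in> upper_central k"
  shows "C [^] int n \<in> upper_central l"
  unfolding assms(1)
proof (rule upper_centralI)
  show "gcomm G (C [^] int n) A \<in> upper_central k"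
    using assms(2) gcomm_CA_A[of n 0] by simp
  show "gcomm G (C [^] int n) B \<in> upper_central k"
    unfolding gcomm_C_pow_B
    by (rule normal.inv_op_closed1[OF normal_upper_central _ assms(3)]) simp
qed simp

lemma A_pow_in_upper_central:
  assumes "l = Suc k" "C [^] int n \<in> upper_central k"
    and "A [^] (\<alpha> * geom_sum \<alpha> n - int n * \<alpha> ^ n) \<in> upper_central k"
  shows "A [^] int n \<in> upper_central l"
  unfolding assms(1)
proof (rule upper_centralI)
  show "gcomm G (A [^] int n) A \<in> upper_central k"
    using subgroup.one_closed[OF subgroup_upper_central]
    by (simp add: gcomm_eq_one_if_commute int_pow_commute)
  show "gcomm G (A [^] int n) B \<in> upper_central k"
    unfolding gcomm_A_pow_B using subgroup_upper_central assms(2,3) by (rule subgroup.m_closed)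
qed simp

lemma C_pow_in_upper_central_2: "C [^] int (2 * q) \<in> upper_central 2"
proof -
  have dvd: "2 * (int q)\<^sup>2 dvd x ^ (2 * q) - 1" if "dyadic_unit (int q) x w" for x w
  proof -
    interpret dyadic_unit "int q" x w by fact
    have "2 * int q dvd geom_sum x (2 * q)"
      using geom_sum_cong_of_nat[OF cong_one, of "2 * q"] by (simp add: cong_dvd_iff)
    then have "int q * (2 * int q) dvd (2 * int q * w) * geom_sum x (2 * q)"
      by (intro mult_dvd_mono) simp_all
    then show ?thesis
      using power_eq_geom_sum[of x "2 * q"] by (simp add: x_eq power2_eq_square mult_ac)
  qed
  have "2 * (int q)\<^sup>2 dvd 1 - \<alpha> ^ (2 * q)" "2 * (int q)\<^sup>2 dvd \<beta> ^ (2 * q) - 1"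
    using dvd \<alpha>.dyadic_unit_axioms \<beta>.dyadic_unit_axioms by (auto simp: dvd_diff_commute)
  then show ?thesis
    using central_macdonald.A_pow_in_upper_central_1[OF central_swap]
    by (intro C_pow_in_upper_central[where k = 1] A_pow_in_upper_central_1) simp_all
qed

lemma A_pow_in_upper_central_3:
  assumes "2 * int q dvd i"
  shows "A [^] (i::int) \<in> upper_central 3"
proof (rule int_pow_dvd_in_subgroup[OF subgroup_upper_central _ assms A_closed])
  let ?n = "2 * q"
  have "[\<alpha> * geom_sum \<alpha> ?n = \<alpha> * int ?n] (mod 2 * (int q)\<^sup>2)"
    by (intro cong_scalar_left \<alpha>.geom_sum_cong_square) simp
  moreover have "[\<alpha> * int ?n = int ?n * \<alpha> ^ ?n] (mod 2 * (int q)\<^sup>2)"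
  proof -
    have "2 * int q dvd \<alpha> - \<alpha> ^ ?n"
      using cong_diff[OF \<alpha>.cong_one \<alpha>.cong_one_power[of ?n]] by (simp add: cong_0_iff)
    then have "int q * (2 * int q) dvd int ?n * (\<alpha> - \<alpha> ^ ?n)" by (intro mult_dvd_mono) simp_all
    then show ?thesis by (simp add: cong_iff_dvd_diff power2_eq_square algebra_simps)
  qed
  ultimately have "2 * (int q)\<^sup>2 dvd \<alpha> * geom_sum \<alpha> ?n - int ?n * \<alpha> ^ ?n"
    using cong_trans cong_iff_dvd_diff by blast
  then have "A [^] (\<alpha> * geom_sum \<alpha> ?n - int ?n * \<alpha> ^ ?n) \<in> upper_central 2"
    using A_pow_in_upper_central_1 upper_central_mono[of 1 2] by auto
  then have "A [^] int ?n \<in> upper_central 3"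
    using C_pow_in_upper_central_2 by (intro A_pow_in_upper_central[where k = 2]) simp_all
  then show "A [^] (2 * int q) \<in> upper_central 3" by (simp only: of_nat_mult of_nat_numeral)
qed

lemma C_in_upper_central_4: "C \<in> upper_central 4"
proof -
  have "2 * int q dvd 1 - \<alpha> ^ 1" "2 * int q dvd \<beta> ^ 1 - 1"
    using \<alpha>.cong_one \<beta>.cong_one by (simp_all add: cong_iff_dvd_diff dvd_diff_commute)
  then have "C [^] int 1 \<in> upper_central 4"
    using central_macdonald.A_pow_in_upper_central_3[OF central_swap]
    by (intro C_pow_in_upper_central[where k = 3] A_pow_in_upper_central_3) simp_all
  then show ?thesis by simp
qed

lemma A_in_upper_central_5: "A \<in> upper_central 5"
proof -
  have "A [^] int 1 \<in> upper_central 5"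
    using C_in_upper_central_4 subgroup.one_closed[OF subgroup_upper_central]
    by (intro A_pow_in_upper_central[where k = 4]) simp_all
  then show ?thesis by simp
qed

lemma lcs_5_trivial: "lcs G (carrier G) 5 = {\<one>}"
proof (rule lcs_trivial_if_upper_central)
  have "{A, B} \<subseteq> upper_central 5"
    using A_in_upper_central_5 central_macdonald.A_in_upper_central_5[OF central_swap] by simp
  then have "generate G {A, B} \<subseteq> upper_central 5"
    by (rule generate_subgroup_incl) (rule subgroup_upper_central)
  then show "upper_central 5 = carrier G"
    using upper_central_carrier unfolding generated[symmetric] by blast
qed

end

subsection \<open>Centralizers of transitive maps\<close>

locale transitive_maps =
  fixes S :: "'a set" and base :: 'a and Rs :: "('a \<Rightarrow> 'a) set"
  assumes finite_S: "finite S" and base_in: "base \<in> S"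
    and maps: "\<And>R x. R \<in> Rs \<Longrightarrow> x \<in> S \<Longrightarrow> R x \<in> S"
    and transitive: "\<And>U. base \<in> U \<Longrightarrow> (\<And>R x. R \<in> Rs \<Longrightarrow> x \<in> S \<Longrightarrow> x \<in> U \<Longrightarrow> R x \<in> U) \<Longrightarrow> S \<subseteq> U"
begin

definition centralizer :: "('a \<Rightarrow> 'a) set" where
  "centralizer = {g \<in> Bij S. \<forall>R\<in>Rs. \<forall>x\<in>S. g (R x) = R (g x)}"

definition centralizer_group :: "('a \<Rightarrow> 'a) monoid" where
  "centralizer_group = BijGroup S\<lparr>carrier := centralizer\<rparr>"

lemma centralizer_in_S: "g \<in> centralizer \<Longrightarrow> x \<in> S \<Longrightarrow> g x \<in> S"
  using Bij_imp_funcset by (fastforce simp: centralizer_def)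

lemma centralizer_commute: "g \<in> centralizer \<Longrightarrow> R \<in> Rs \<Longrightarrow> x \<in> S \<Longrightarrow> g (R x) = R (g x)"
  by (simp add: centralizer_def)

lemma restrict_in_centralizerI:
  assumes f: "\<And>x. x \<in> S \<Longrightarrow> f x \<in> S" and comm: "\<And>R x. R \<in> Rs \<Longrightarrow> x \<in> S \<Longrightarrow> f (R x) = R (f x)"
    and base: "base \<in> f ` S"
  shows "restrict f S \<in> centralizer"
proof -
  have "S \<subseteq> f ` S"
  proof (rule transitive)
    fix R x assume R: "R \<in> Rs" "x \<in> f ` S"
    then obtain y where "y \<in> S" "x = f y" by blast
    then show "R x \<in> f ` S" using R(1) comm maps by (metis imageI)
  qed (rule base)
  then have "f ` S = S" using f by blast
  moreover from this have "inj_on f S" using finite_S by (simp add: eq_card_imp_inj_on)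
  ultimately have "restrict f S \<in> Bij S" by (simp add: Bij_def bij_betw_def)
  then show ?thesis using comm maps f by (simp add: centralizer_def)
qed

lemma subgroup_centralizer: "subgroup centralizer (BijGroup S)"
proof (rule group.subgroupI[OF group_BijGroup])
  show "centralizer \<subseteq> carrier (BijGroup S)" by (auto simp: centralizer_def BijGroup_def)
  have "(\<lambda>x\<in>S. x) \<in> centralizer" by (rule restrict_in_centralizerI) (simp_all add: base_in)
  then show "centralizer \<noteq> {}" by blast
next
  fix g assume g: "g \<in> centralizer"
  then have Bij: "g \<in> Bij S" and surj: "g ` S = S"
    by (simp_all add: centralizer_def Bij_def bij_betw_def)
  have "restrict (inv_into S g) S \<in> centralizer"
  proof (rule restrict_in_centralizerI)
    fix R x assume R: "R \<in> Rs" "x \<in> S"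
    define y where "y = inv_into S g x"
    have y: "y \<in> S" "g y = x" using R(2) surj by (simp_all add: y_def inv_into_into f_inv_into_f)
    then have "inv_into S g (R x) = inv_into S g (g (R y))"
      using centralizer_commute[OF g R(1)] by simp
    also have "\<dots> = R y" using Bij maps[OF R(1) y(1)] by (simp add: Bij_def bij_betw_def)
    finally show "inv_into S g (R x) = R (inv_into S g x)" by (simp add: y_def)
  next
    show "base \<in> inv_into S g ` S"
      using Bij base_in by (metis Bij_def IntD2 bij_betw_inv_into bij_betw_imp_surj_on mem_Collect_eq)
  qed (simp add: Bij Bij_inv_into_mem)
  then show "inv\<^bsub>BijGroup S\<^esub> g \<in> centralizer" using Bij by (simp add: inv_BijGroup restrict_def)
next
  fix g h assume "g \<in> centralizer" "h \<in> centralizer"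
  moreover from this have "compose S g h \<in> Bij S" by (simp add: centralizer_def compose_Bij)
  ultimately show "g \<otimes>\<^bsub>BijGroup S\<^esub> h \<in> centralizer"
    using maps by (simp add: centralizer_def BijGroup_def compose_eq Bij_imp_funcset[THEN funcset_mem])
qed

abbreviation "Q \<equiv> centralizer_group"

sublocale Q: group Q
  unfolding centralizer_group_def
  by (rule subgroup.subgroup_is_group[OF subgroup_centralizer group_BijGroup])

lemma carrier_centralizer_group: "carrier Q = centralizer"
  by (simp add: centralizer_group_def)

lemma mult_apply: "g \<in> centralizer \<Longrightarrow> h \<in> centralizer \<Longrightarrow> x \<in> S \<Longrightarrow> (g \<otimes>\<^bsub>Q\<^esub> h) x = g (h x)"
  by (simp add: centralizer_group_def centralizer_def BijGroup_def compose_eq)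

lemma one_apply: "x \<in> S \<Longrightarrow> \<one>\<^bsub>Q\<^esub> x = x"
  by (simp add: centralizer_group_def BijGroup_def)

lemma pow_apply: "g \<in> centralizer \<Longrightarrow> x \<in> S \<Longrightarrow> (g [^]\<^bsub>Q\<^esub> (n::nat)) x = (g ^^ n) x"
proof (induction n arbitrary: x)
  case (Suc n)
  have "g [^]\<^bsub>Q\<^esub> n \<in> centralizer"
    using Suc.prems(1) Q.nat_pow_closed[of g n] by (simp add: carrier_centralizer_group)
  then have "(g [^]\<^bsub>Q\<^esub> Suc n) x = (g [^]\<^bsub>Q\<^esub> n) (g x)"
    using Suc.prems by (simp add: mult_apply)
  then show ?case using Suc by (simp add: centralizer_in_S funpow_Suc_right del: funpow.simps)
qed (simp add: one_apply)

lemma centralizer_eqI: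
  assumes "g \<in> centralizer" "h \<in> centralizer" "g base = h base"
  shows "g = h"
proof (rule extensionalityI)
  show "g \<in> extensional S" "h \<in> extensional S"
    using assms Bij_imp_extensional by (auto simp: centralizer_def)
  have "S \<subseteq> {x. g x = h x}"
    by (rule transitive) (use assms in \<open>auto simp: centralizer_commute\<close>)
  then show "g x = h x" if "x \<in> S" for x using that by blast
qed

lemma ord_eqI:
  assumes "g \<in> centralizer" "\<And>n. (g ^^ n) base = base \<longleftrightarrow> d dvd n"
  shows "Q.ord g = d"
proof -
  have "g [^]\<^bsub>Q\<^esub> n = \<one>\<^bsub>Q\<^esub> \<longleftrightarrow> (g ^^ n) base = base" for n :: nat
  proof -
    have "g [^]\<^bsub>Q\<^esub> n \<in> centralizer" "\<one>\<^bsub>Q\<^esub> \<in> centralizer"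
      using assms(1) Q.nat_pow_closed[of g n] Q.one_closed by (simp_all add: carrier_centralizer_group)
    then have "g [^]\<^bsub>Q\<^esub> n = \<one>\<^bsub>Q\<^esub> \<longleftrightarrow> (g [^]\<^bsub>Q\<^esub> n) base = \<one>\<^bsub>Q\<^esub> base"
      using centralizer_eqI[of "g [^]\<^bsub>Q\<^esub> n" "\<one>\<^bsub>Q\<^esub>"] by metis
    then show ?thesis by (simp add: pow_apply[OF assms(1) base_in] one_apply[OF base_in])
  qed
  then show ?thesis using assms by (simp add: Q.ord_unique carrier_centralizer_group)
qed

lemma
  assumes E: "E \<subseteq> centralizer" and reach: "\<And>x. x \<in> S \<Longrightarrow> \<exists>h\<in>generate Q E. h base = x"
  shows carrier_eq_generate_if_transitive: "carrier Q = generate Q E"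
    and order_eq_card_if_transitive: "order Q = card S"
proof -
  have sub: "generate Q E \<subseteq> centralizer"
    using Q.generate_incl[of E] E by (simp add: carrier_centralizer_group)
  have "g \<in> generate Q E" if g: "g \<in> centralizer" for g
  proof -
    obtain h where h: "h \<in> generate Q E" "h base = g base"
      using reach centralizer_in_S[OF g base_in] by blast
    then have "g = h" using g sub by (intro centralizer_eqI) auto
    then show ?thesis using h(1) by simp
  qed
  then show "carrier Q = generate Q E" using sub by (auto simp: carrier_centralizer_group)
  have "bij_betw (\<lambda>g. g base) centralizer S"
    unfolding bij_betw_def
  proof
    show "inj_on (\<lambda>g. g base) centralizer" by (rule inj_onI) (rule centralizer_eqI)
    show "(\<lambda>g. g base) ` centralizer = S"
      using reach sub centralizer_in_S[OF _ base_in] by (fastforce simp: image_iff)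
  qed
  then show "order Q = card S"
    by (simp add: order_def carrier_centralizer_group bij_betw_same_card)
qed

end

subsection \<open>A group of order \<open>16 q\<^sup>7\<close>\<close>

lemma (in group) macdonald_of_inverses:
  assumes [simp]: "x \<in> carrier G" "y \<in> carrier G" "c \<in> carrier G"
    and xy: "x \<otimes> y = c \<otimes> (y \<otimes> x)" and xc: "x \<otimes> c = c \<otimes> x [^] (a::nat)" and cy: "c \<otimes> y = y [^] (b::nat) \<otimes> c"
  shows "macdonald G (inv x) (inv y) (int a) (int b)" "gcomm G (inv x) (inv y) = c"
proof -
  have "gcomm G (inv x) (inv y) = (x \<otimes> y) \<otimes> (inv x \<otimes> inv y)" by (simp add: gcomm_def m_assoc)
  then show comm: "gcomm G (inv x) (inv y) = c" by (simp add: xy m_assoc mult_inv_cancel_left)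
  have "inv c \<otimes> x \<otimes> c = x [^] a" by (simp add: m_assoc xc inv_mult_cancel_left)
  then have x: "inv c \<otimes> inv x \<otimes> c = inv (x [^] a)"
    by (metis assms(1,3) inv_closed inv_inv inv_mult_group m_assoc m_closed)
  have "c \<otimes> y \<otimes> inv c = y [^] b" by (simp add: m_assoc cy)
  then have y: "c \<otimes> inv y \<otimes> inv c = inv (y [^] b)"
    by (metis assms(2,3) inv_closed inv_inv inv_mult_group m_assoc m_closed)
  show "macdonald G (inv x) (inv y) (int a) (int b)"
    by unfold_locales (simp_all add: comm x y int_pow_int nat_pow_inv)
qed

locale macdonald_model = dyadic_unit_pair "int q" "int a" "int b" u v for q a b :: nat and u v
begin

definition p :: nat where "p = 2 * q\<^sup>2"
definition N :: nat where "N = 4 * q ^ 3"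

lemma int_p: "int p = 2 * (int q)\<^sup>2" and int_N: "int N = 4 * int q ^ 3"
  by (simp_all add: p_def N_def)

lemma q_pos: "q > 0" and p_pos: "p > 0" and N_pos: "N > 0"
  using \<alpha>.q_nonzero by (simp_all add: p_def N_def)

lemma p_dvd_N: "int p dvd int N"
  unfolding int_p int_N by (rule \<alpha>.two_square_dvd_four_cube)

lemma model_swap: "macdonald_model q b a v u"
  by (intro macdonald_model.intro pair_swap)

text \<open>The triple \<open>(i, j, k)\<close> stands for \<open>B\<^sup>-\<^sup>i C\<^sup>j A\<^sup>k\<close>. The reduction uses the relations
  \<open>A\<^sup>N = 1\<close>, \<open>B\<^sup>-\<^sup>p = A\<^sup>p\<close> and \<open>C\<^sup>p = A\<^sup>q\<^sup>p\<close>, the following maps are left multiplications by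
  \<open>A\<^sup>-\<^sup>1\<close>, \<open>B\<^sup>-\<^sup>1\<close>, \<open>C\<close> and right multiplications by \<open>A\<close>, \<open>B\<close>, \<open>C\<close>. Exponents are natural
  numbers, so that \<open>N - 1\<close> plays the role of \<open>- 1\<close>.\<close>

fun reduce :: "nat \<times> nat \<times> nat \<Rightarrow> nat \<times> nat \<times> nat" where
  "reduce (i, j, k) = (i mod p, j mod p, (k + p * (i div p) + q * p * (j div p)) mod N)"

declare reduce.simps [simp del]

fun weight :: "nat \<times> nat \<times> nat \<Rightarrow> int" where
  "weight (i, j, k) = int k + int i + int q * int j"

declare weight.simps [simp del]

fun left_A :: "nat \<times> nat \<times> nat \<Rightarrow> nat \<times> nat \<times> nat" where
  "left_A (i, j, k) = (b * geom_sum b i, i + j, k + (N - 1) * a ^ j)"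

fun left_B :: "nat \<times> nat \<times> nat \<Rightarrow> nat \<times> nat \<times> nat" where
  "left_B (i, j, k) = (Suc i, j, k)"

fun left_C :: "nat \<times> nat \<times> nat \<Rightarrow> nat \<times> nat \<times> nat" where
  "left_C (i, j, k) = (b * i, Suc j, k)"

fun right_A :: "nat \<times> nat \<times> nat \<Rightarrow> nat \<times> nat \<times> nat" where
  "right_A (i, j, k) = (i, j, Suc k)"

fun right_B :: "nat \<times> nat \<times> nat \<Rightarrow> nat \<times> nat \<times> nat" where
  "right_B (i, j, k) = (i + (N - 1) * b ^ j, j + k, a * geom_sum a k)"

fun right_C :: "nat \<times> nat \<times> nat \<Rightarrow> nat \<times> nat \<times> nat" where
  "right_C (i, j, k) = (i, Suc j, a * k)"

lemma reduce_eq_iff: "reduce (i, j, k) = reduce (i', j', k') \<longleftrightarrow>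
  [int i = int i'] (mod int p) \<and> [int j = int j'] (mod int p) \<and>
  [weight (i, j, k) = weight (i', j', k')] (mod int N)"
proof -
  let ?r = "\<lambda>i j k. k + p * (i div p) + q * p * (j div p)"
  have "[?r i j k = ?r i' j' k'] (mod N) \<longleftrightarrow> [k + i + q * j = k' + i' + q * j'] (mod N)"
    if "i mod p = i' mod p" "j mod p = j' mod p"
  proof -
    have "k + i + q * j = ?r i j k + (i mod p + q * (j mod p))" for i j k
    proof -
      have "q * j = q * p * (j div p) + q * (j mod p)"
        by (metis distrib_left mult.assoc mult_div_mod_eq)
      moreover have "i = p * (i div p) + i mod p" by simp
      ultimately show ?thesis by linarith
    qed
    from this[of k i j] this[of k' i' j'] show ?thesis
      using that by (simp only: cong_add_rcancel_nat)
  qed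
  then have "reduce (i, j, k) = reduce (i', j', k') \<longleftrightarrow>
    [i = i'] (mod p) \<and> [j = j'] (mod p) \<and> [k + i + q * j = k' + i' + q * j'] (mod N)"
    unfolding reduce.simps prod.inject cong_def by blast
  then show ?thesis by (simp add: weight.simps flip: cong_int_iff)
qed

lemma
  assumes "reduce (i, j, k) = reduce (i', j', k')"
  shows cong_first_if_reduce_eq: "[int i = int i'] (mod int p)"
    and cong_second_if_reduce_eq: "[int j = int j'] (mod int p)"
    and cong_third_if_reduce_eq: "[int k = int k'] (mod int p)"
    and cong_weight_if_reduce_eq: "[weight (i, j, k) = weight (i', j', k')] (mod int N)"
proof -
  show i: "[int i = int i'] (mod int p)" and j: "[int j = int j'] (mod int p)"
    and w: "[weight (i, j, k) = weight (i', j', k')] (mod int N)"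
    using assms by (simp_all add: reduce_eq_iff)
  have "[weight (i, j, k) - int i - int q * int j = weight (i', j', k') - int i' - int q * int j'] (mod int p)"
    by (intro cong_diff cong_scalar_left i j cong_dvd_modulus[OF w p_dvd_N])
  then show "[int k = int k'] (mod int p)" by (simp add: weight.simps)
qed

fun flip :: "nat \<times> nat \<times> nat \<Rightarrow> nat \<times> nat \<times> nat" where
  "flip (i, j, k) = (k, j, i)"

lemma reduce_flip:
  assumes "reduce t = reduce t'"
  shows "reduce (flip t) = reduce (flip t')"
proof (cases t; cases t')
  fix i j k i' j' k' assume t: "t = (i, j, k)" "t' = (i', j', k')"
  have eq: "reduce (i, j, k) = reduce (i', j', k')" using assms by (simp only: t)
  have "weight (k, j, i) = weight (i, j, k)" for i j k by (simp add: weight.simps)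
  then show ?thesis
    using cong_second_if_reduce_eq[OF eq] cong_third_if_reduce_eq[OF eq] cong_weight_if_reduce_eq[OF eq]
    by (simp only: t flip.simps reduce_eq_iff)
qed

definition compatible :: "(nat \<times> nat \<times> nat \<Rightarrow> nat \<times> nat \<times> nat) \<Rightarrow> bool" where
  "compatible f \<longleftrightarrow> (\<forall>t t'. reduce t = reduce t' \<longrightarrow> reduce (f t) = reduce (f t'))"

lemma compatibleI:
  assumes "\<And>i j k i' j' k'. reduce (i, j, k) = reduce (i', j', k') \<Longrightarrow>
    reduce (f (i, j, k)) = reduce (f (i', j', k'))"
  shows "compatible f"
  using assms unfolding compatible_def split_paired_All by blast

lemma compatible_flip: "compatible f \<Longrightarrow> compatible (flip \<circ> f \<circ> flip)"
  unfolding compatible_def comp_def by (blast intro: reduce_flip)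

lemma compatible_right_A: "compatible right_A"
proof (rule compatibleI)
  fix i j k i' j' k' assume t: "reduce (i, j, k) = reduce (i', j', k')"
  have "weight (i, j, Suc k) = weight (i, j, k) + 1" for i j k by (simp add: weight.simps)
  then have "[weight (i, j, Suc k) = weight (i', j', Suc k')] (mod int N)"
    using cong_weight_if_reduce_eq[OF t] by (simp add: cong_add_rcancel)
  then show "reduce (right_A (i, j, k)) = reduce (right_A (i', j', k'))"
    using t by (simp add: reduce_eq_iff)
qed

lemma compatible_right_C: "compatible right_C"
proof (rule compatibleI)
  fix i j k i' j' k' assume t: "reduce (i, j, k) = reduce (i', j', k')"
  have weight: "weight (i, Suc j, a * k) = weight (i, j, k) + (int a * int k - int k) + int q" for i j k
    by (simp add: weight.simps algebra_simps)
  have "[int a * int k - int k = int a * int k' - int k'] (mod int N)"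
    unfolding int_N using cong_third_if_reduce_eq[OF t] by (intro \<alpha>.mult_minus_self_cong) (simp only: int_p)
  then have "[weight (i, Suc j, a * k) = weight (i', Suc j', a * k')] (mod int N)"
    unfolding weight by (intro cong_add[OF cong_add] cong_weight_if_reduce_eq[OF t] cong_refl)
  moreover have "[int (Suc j) = int (Suc j')] (mod int p)"
    using cong_second_if_reduce_eq[OF t] by (simp add: cong_add)
  ultimately show "reduce (right_C (i, j, k)) = reduce (right_C (i', j', k'))"
    using cong_first_if_reduce_eq[OF t] by (simp only: right_C.simps reduce_eq_iff)
qed

lemma compatible_right_B: "compatible right_B"
proof (rule compatibleI)
  fix i j k i' j' k' assume t: "reduce (i, j, k) = reduce (i', j', k')"
  note ijk = cong_first_if_reduce_eq[OF t] cong_second_if_reduce_eq[OF t] cong_third_if_reduce_eq[OF t]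
  let ?e = "\<lambda>k. int a * geom_sum (int a) k - (1 + int q) * int k"
  have weight: "weight (i + (N - 1) * b ^ j, j + k, a * geom_sum a k)
      = ?e k + weight (i, j, k) + 2 * int q * int k + int (N - 1) * int b ^ j" for i j k
    by (simp only: weight.simps of_nat_add of_nat_mult of_nat_power of_nat_geom_sum)
      (simp add: algebra_simps)
  have e: "[?e k = ?e k'] (mod int N)"
    using \<alpha>.geom_sum_periodic ijk(3) by (simp only: int_p int_N)
  have "(2 * int q) * int p = int N"
    by (simp add: int_p int_N power2_eq_square power3_eq_cube)
  then have two_q: "[2 * int q * int k = 2 * int q * int k'] (mod int N)"
    using cong_cmult_leftI[OF ijk(3), of "2 * int q"] by simp
  have power: "[int (N - 1) * int b ^ j = int (N - 1) * int b ^ j'] (mod int N)"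
    using \<beta>.power_periodic ijk(2) by (intro cong_scalar_left) (simp only: int_p int_N)
  have "[weight (i + (N - 1) * b ^ j, j + k, a * geom_sum a k)
      = weight (i' + (N - 1) * b ^ j', j' + k', a * geom_sum a k')] (mod int N)"
    unfolding weight by (rule cong_add[OF cong_add[OF cong_add[OF e cong_weight_if_reduce_eq[OF t]] two_q] power])
  moreover have "[int (i + (N - 1) * b ^ j) = int (i' + (N - 1) * b ^ j')] (mod int p)"
    using cong_add[OF ijk(1) cong_dvd_modulus[OF power p_dvd_N]] by simp
  moreover have "[int (j + k) = int (j' + k')] (mod int p)"
    using cong_add[OF ijk(2,3)] by simp
  ultimately show "reduce (right_B (i, j, k)) = reduce (right_B (i', j', k'))"
    by (simp only: right_B.simps reduce_eq_iff)
qed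

lemma compatible_left_A: "compatible left_A"
proof -
  interpret swapped: macdonald_model q b a v u by (rule model_swap)
  have "left_A = flip \<circ> swapped.right_B \<circ> flip" by (auto simp: fun_eq_iff add_ac)
  then show ?thesis using compatible_flip[OF swapped.compatible_right_B] by simp
qed

lemma compatible_left_B: "compatible left_B"
proof -
  have "left_B = flip \<circ> right_A \<circ> flip" by auto
  then show ?thesis using compatible_flip[OF compatible_right_A] by simp
qed

lemma compatible_left_C: "compatible left_C"
proof -
  interpret swapped: macdonald_model q b a v u by (rule model_swap)
  have "left_C = flip \<circ> swapped.right_C \<circ> flip" by auto
  then show ?thesis using compatible_flip[OF swapped.compatible_right_C] by simp
qed

lemma relator_exponent_cong_left_right:
  "[relator_exponent (int a) j = relator_exponent (int b) j] (mod int N)"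
  unfolding int_N by (rule relator_exponent_cong_pair) simp_all

lemma power_cong_left_right:
  shows "[int a ^ j = int b ^ j] (mod int p)"
    and "[int q * int a ^ j = int q * int b ^ j] (mod int N)"
proof -
  have pow: "[int a ^ j = int b ^ j] (mod 4 * (int q)\<^sup>2)"
    by (intro cong_pow \<alpha>_cong_\<beta>)
  then show "[int a ^ j = int b ^ j] (mod int p)"
    by (rule cong_dvd_modulus) (simp add: int_p)
  have "[int q * int a ^ j = int q * int b ^ j] (mod int q * (4 * (int q)\<^sup>2))"
    using pow by (rule cong_cmult_leftI)
  then show "[int q * int a ^ j = int q * int b ^ j] (mod int N)"
    by (simp add: int_N power2_eq_square power3_eq_cube mult_ac)
qed

lemma cong_minus_mult: "[int (i + (N - 1) * n) = int i - int n] (mod int N)"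
proof -
  have "int (N - 1) = int N - 1" using N_pos by (simp add: of_nat_diff)
  then have "int (i + (N - 1) * n) = int i - int n + int N * int n"
    by (simp only: of_nat_add of_nat_mult) (simp add: algebra_simps)
  then show ?thesis by (simp add: cong_iff_dvd_diff)
qed

lemma exponent_shift:
  "[int (a * geom_sum a k + (N - 1) * a ^ (k + j))
    = int (a * geom_sum a (k + (N - 1) * a ^ j)) + relator_exponent (int a) j] (mod int N)"
proof -
  let ?k = "k + (N - 1) * a ^ j"
  have "[int ?k + int a ^ j = int k - int a ^ j + int a ^ j] (mod int N)"
    using cong_minus_mult[of k "a ^ j"] by (intro cong_add cong_refl) simp
  then have "[int k = int ?k + int a ^ j] (mod 4 * int q ^ 3)"
    by (simp only: diff_add_cancel int_N cong_sym_eq)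
  then have "[int a * geom_sum (int a) k - int a ^ (k + j)
      = int a * geom_sum (int a) ?k + relator_exponent (int a) j] (mod int N)"
    unfolding int_N by (intro \<alpha>.relator_exponent_shift) simp_all
  moreover have "[int (a * geom_sum a k + (N - 1) * a ^ (k + j))
      = int a * geom_sum (int a) k - int a ^ (k + j)] (mod int N)"
    using cong_minus_mult[of "a * geom_sum a k" "a ^ (k + j)"]
    by (simp only: of_nat_mult of_nat_power of_nat_geom_sum)
  ultimately show ?thesis unfolding of_nat_mult of_nat_geom_sum by (blast intro: cong_trans)
qed

lemma middle_exponent_cong:
  shows "[int (i + (N - 1) * b ^ j + (j + k)) = int (i + j + (k + (N - 1) * a ^ j))] (mod int p)"
    (is "[?l = ?r] (mod _)")
    and "[int q * int (i + (N - 1) * b ^ j + (j + k)) = int q * int (i + j + (k + (N - 1) * a ^ j))] (mod int N)"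
proof -
  let ?t = "int i + int j + int k"
  have l: "[?l = ?t - int b ^ j] (mod int N)"
    using cong_minus_mult[of "i + j + k" "b ^ j"] by (simp add: algebra_simps)
  have r: "[?r = ?t - int a ^ j] (mod int N)"
    using cong_minus_mult[of "i + j + k" "a ^ j"] by (simp add: algebra_simps)
  have "[?t - int b ^ j = ?t - int a ^ j] (mod int p)"
    by (intro cong_diff cong_refl cong_sym[OF power_cong_left_right(1)])
  then show "[?l = ?r] (mod int p)"
    using cong_dvd_modulus[OF l p_dvd_N] cong_dvd_modulus[OF r p_dvd_N] by (meson cong_sym cong_trans)
  have "[int q * (?t - int b ^ j) = int q * (?t - int a ^ j)] (mod int N)"
    unfolding right_diff_distrib by (intro cong_diff cong_refl cong_sym[OF power_cong_left_right(2)])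
  then show "[int q * ?l = int q * ?r] (mod int N)"
    using cong_scalar_left[OF l] cong_scalar_left[OF r] by (meson cong_sym cong_trans)
qed

text \<open>The only commutation of a left with a right multiplication that is not a formal identity.\<close>

lemma left_A_right_B_commute: "reduce (left_A (right_B t)) = reduce (right_B (left_A t))"
proof (cases t)
  fix i j k assume t: "t = (i, j, k)"
  interpret swapped: macdonald_model q b a v u by (rule model_swap)
  define i' k' where "i' = i + (N - 1) * b ^ j" and "k' = k + (N - 1) * a ^ j"
  define r s where "r = b * geom_sum b i + (N - 1) * b ^ (i + j)"
    and "s = a * geom_sum a k + (N - 1) * a ^ (j + k)"
  let ?ga = "int (a * geom_sum a k')" and ?gb = "int (b * geom_sum b i')"
  let ?e = "relator_exponent (int b) j"
  have r: "[int r = ?gb + ?e] (mod int N)"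
    using swapped.exponent_shift[of i j] by (simp only: r_def i'_def)
  have "[int s = ?ga + relator_exponent (int a) j] (mod int N)"
    using exponent_shift[of k j] by (simp only: s_def k'_def add.commute[of j])
  also have "[?ga + relator_exponent (int a) j = ?ga + ?e] (mod int N)"
    by (intro cong_add cong_refl relator_exponent_cong_left_right)
  finally have "[int s + ?gb = ?ga + ?e + ?gb] (mod int N)"
    by (intro cong_add cong_refl)
  also have "[?ga + ?e + ?gb = ?ga + int r] (mod int N)"
    using cong_add[OF cong_refl cong_sym[OF r], of ?ga] by (simp add: add_ac)
  finally have "[int s + ?gb + int q * int (i' + (j + k)) = ?ga + int r + int q * int (i + j + k')] (mod int N)"
    using middle_exponent_cong(2)[of i j k] unfolding i'_def[symmetric] k'_def[symmetric] by (rule cong_add)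
  then have weight: "[weight (b * geom_sum b i', i' + (j + k), s)
      = weight (r, i + j + k', a * geom_sum a k')] (mod int N)"
    by (simp only: weight.simps)
  have "[?e = 0] (mod int p)"
    using \<beta>.relator_exponent_dvd[of j] by (simp add: cong_0_iff int_p)
  then have "[int r = ?gb] (mod int p)"
    using cong_trans[OF cong_dvd_modulus[OF r p_dvd_N] cong_add[OF cong_refl]] by fastforce
  with weight have "reduce (b * geom_sum b i', i' + (j + k), s) = reduce (r, i + j + k', a * geom_sum a k')"
    using middle_exponent_cong(1)[of i j k]
    by (simp only: reduce_eq_iff i'_def[symmetric] k'_def[symmetric] cong_sym_eq)
  then show ?thesis by (simp only: t left_A.simps right_B.simps r_def s_def i'_def k'_def)
qed

lemma reduce_reduce [simp]: "reduce (reduce t) = reduce t"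
  using p_pos by (cases t) (simp add: reduce.simps)

lemma range_reduce: "range reduce = {..<p} \<times> {..<p} \<times> {..<N}"
proof (intro subset_antisym subsetI)
  fix t assume "t \<in> {..<p} \<times> {..<p} \<times> {..<N}"
  then have "reduce t = t" by (auto simp: reduce.simps)
  then show "t \<in> range reduce" by (metis rangeI)
qed (use p_pos N_pos in \<open>auto simp: reduce.simps\<close>)

lemma card_range_reduce: "card (range reduce) = 16 * q ^ 7"
  by (simp add: range_reduce card_cartesian_product p_def N_def power_numeral_reduce)

definition lift :: "(nat \<times> nat \<times> nat \<Rightarrow> nat \<times> nat \<times> nat) \<Rightarrow> nat \<times> nat \<times> nat \<Rightarrow> nat \<times> nat \<times> nat" where
  "lift f = restrict (reduce \<circ> f) (range reduce)"

lemma compatible_reduce: "compatible f \<Longrightarrow> reduce (f (reduce t)) = reduce (f t)"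
  unfolding compatible_def by (metis reduce_reduce)

lemma lift_reduce: "compatible f \<Longrightarrow> lift f (reduce t) = reduce (f t)"
  by (simp add: lift_def compatible_reduce)

lemma lift_funpow_reduce: "compatible f \<Longrightarrow> (lift f ^^ n) (reduce t) = reduce ((f ^^ n) t)"
  by (induction n) (simp_all add: lift_reduce)

lemma left_A_funpow: "(left_A ^^ n) (0, 0, k) = (0, 0, k + n * (N - 1))"
  by (induction n) simp_all

lemma left_B_funpow: "(left_B ^^ n) (i, j, k) = (i + n, j, k)"
  by (induction n) simp_all

lemma left_C_funpow: "(left_C ^^ n) (0, j, k) = (0, j + n, k)"
  by (induction n) simp_all

lemma right_A_funpow: "(right_A ^^ n) (i, j, k) = (i, j, k + n)"
  by (induction n) simp_all

lemma right_B_funpow: "(right_B ^^ n) (i, 0, 0) = (i + n * (N - 1), 0, 0)"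
  by (induction n) simp_all

lemma right_C_funpow: "(right_C ^^ n) (i, j, 0) = (i, j + n, 0)"
  by (induction n) simp_all

lemma reduce_negate_twice:
  shows "reduce (i * (N - 1) * (N - 1), j, k) = reduce (i, j, k)"
    and "reduce (i, j, k * (N - 1) * (N - 1)) = reduce (i, j, k)"
proof -
  have neg: "[int (n * (N - 1) * (N - 1)) = int n] (mod int N)" for n
  proof -
    have "[int (n * (N - 1) * (N - 1)) = - int (n * (N - 1))] (mod int N)"
      using cong_minus_mult[of 0 "n * (N - 1)"] by (simp add: mult_ac)
    also have "[- int (n * (N - 1)) = - (- int n)] (mod int N)"
      using cong_minus_mult[of 0 n] by (intro cong_uminus) (simp add: mult.commute)
    finally show ?thesis by simp
  qed
  have "[weight (i', j, k') = weight (i, j, k)] (mod int N)"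
    if "[int i' = int i] (mod int N)" "[int k' = int k] (mod int N)" for i' k'
    unfolding weight.simps by (intro cong_add cong_refl that)
  then show "reduce (i * (N - 1) * (N - 1), j, k) = reduce (i, j, k)"
      "reduce (i, j, k * (N - 1) * (N - 1)) = reduce (i, j, k)"
    using neg cong_dvd_modulus[OF neg p_dvd_N] by (simp_all only: reduce_eq_iff cong_refl)
qed

sublocale transitive_maps "range reduce" "reduce (0, 0, 0)" "{lift right_A, lift right_B, lift right_C}"
proof
  show "finite (range reduce)" by (simp add: range_reduce)
  show "reduce (0, 0, 0) \<in> range reduce" by simp
  have compatible: "compatible f" if "f \<in> {right_A, right_B, right_C}" for f
    using that compatible_right_A compatible_right_B compatible_right_C by auto
  show "R x \<in> range reduce"
    if "R \<in> {lift right_A, lift right_B, lift right_C}" "x \<in> range reduce" for R x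
    using that by (auto simp: lift_def)
  fix U assume base: "reduce (0, 0, 0) \<in> U"
    and maps_U: "\<And>R x. R \<in> {lift right_A, lift right_B, lift right_C} \<Longrightarrow> x \<in> range reduce \<Longrightarrow> x \<in> U \<Longrightarrow> R x \<in> U"
  have funpow: "reduce ((f ^^ n) t) \<in> U"
    if f: "f \<in> {right_A, right_B, right_C}" and t: "reduce t \<in> U" for f t n
  proof (induction n)
    case (Suc n)
    have "lift f \<in> {lift right_A, lift right_B, lift right_C}" using f by auto
    then have "lift f (reduce ((f ^^ n) t)) \<in> U" by (rule maps_U[OF _ rangeI Suc])
    then show ?case using compatible[OF f] by (simp add: lift_reduce)
  qed (use t in simp)
  show "range reduce \<subseteq> U"
  proof
    fix x assume "x \<in> range reduce"
    then obtain i j k where x: "x = reduce (i, j, k)" by (metis imageE prod_cases3)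
    have "reduce (i * (N - 1) * (N - 1), 0, 0) \<in> U"
      using funpow[of right_B "(0, 0, 0)" "i * (N - 1)"] base by (simp add: right_B_funpow)
    then have "reduce (i, 0, 0) \<in> U" by (simp only: reduce_negate_twice)
    then have "reduce (i, j, 0) \<in> U" using funpow[of right_C "(i, 0, 0)" j] by (simp add: right_C_funpow)
    then show "x \<in> U" using funpow[of right_A "(i, j, 0)" k] by (simp add: x right_A_funpow)
  qed
qed

lemma lift_in_centralizerI:
  assumes f: "compatible f" and base: "reduce (f t) = reduce (0, 0, 0)"
    and comm: "\<And>g t. g \<in> {right_A, right_B, right_C} \<Longrightarrow> reduce (f (g t)) = reduce (g (f t))"
  shows "lift f \<in> centralizer"
proof -
  have "restrict (reduce \<circ> f) (range reduce) \<in> centralizer"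
  proof (rule restrict_in_centralizerI)
    fix R x assume "R \<in> {lift right_A, lift right_B, lift right_C}" and x: "x \<in> range reduce"
    then obtain g where g: "g \<in> {right_A, right_B, right_C}" "R = lift g" by auto
    obtain t where t: "x = reduce t" using x by blast
    have "compatible g" using g(1) compatible_right_A compatible_right_B compatible_right_C by auto
    then show "(reduce \<circ> f) (R x) = R ((reduce \<circ> f) x)"
      using comm[OF g(1)] f by (simp add: g(2) t lift_reduce compatible_reduce)
  next
    show "reduce (0, 0, 0) \<in> (reduce \<circ> f) ` range reduce"
      using compatible_reduce[OF f, of t] base by (metis comp_apply imageI rangeI)
  qed simp
  then show ?thesis by (simp only: lift_def)
qed

lemma left_A_in_centralizer: "lift left_A \<in> centralizer"
proof (rule lift_in_centralizerI[OF compatible_left_A])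
  show "reduce (left_A (0, 0, 1)) = reduce (0, 0, 0)"
    using N_pos by (simp add: reduce.simps)
  fix g and t :: "nat \<times> nat \<times> nat" assume g: "g \<in> {right_A, right_B, right_C}"
  obtain i j k where t: "t = (i, j, k)" by (cases t)
  have "left_A (right_A t) = right_A (left_A t)" "left_A (right_C t) = right_C (left_A t)"
    by (simp_all add: t algebra_simps)
  then show "reduce (left_A (g t)) = reduce (g (left_A t))"
    using g left_A_right_B_commute[of t] by auto
qed

lemma left_B_in_centralizer: "lift left_B \<in> centralizer"
proof (rule lift_in_centralizerI[OF compatible_left_B])
  have "Suc (p * N - 1) = p * N" using p_pos N_pos by simp
  then show "reduce (left_B (p * N - 1, 0, 0)) = reduce (0, 0, 0)"
    using p_pos by (simp add: reduce.simps)
  fix g and t :: "nat \<times> nat \<times> nat" assume "g \<in> {right_A, right_B, right_C}"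
  then show "reduce (left_B (g t)) = reduce (g (left_B t))"
    by (cases t) auto
qed

lemma left_C_in_centralizer: "lift left_C \<in> centralizer"
proof (rule lift_in_centralizerI[OF compatible_left_C])
  have "Suc (p * N - 1) = p * N" using p_pos N_pos by simp
  then show "reduce (left_C (0, p * N - 1, 0)) = reduce (0, 0, 0)"
    using p_pos by (simp add: reduce.simps)
  fix g and t :: "nat \<times> nat \<times> nat" assume "g \<in> {right_A, right_B, right_C}"
  then show "reduce (left_C (g t)) = reduce (g (left_C t))"
    by (cases t) (auto simp: algebra_simps)
qed

abbreviation "La \<equiv> lift left_A"
abbreviation "Lb \<equiv> lift left_B"
abbreviation "Lc \<equiv> lift left_C"

lemma La_closed [simp]: "La \<in> carrier Q" and Lb_closed [simp]: "Lb \<in> carrier Q"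
  and Lc_closed [simp]: "Lc \<in> carrier Q"
  by (simp_all add: carrier_centralizer_group left_A_in_centralizer left_B_in_centralizer left_C_in_centralizer)

lemma left_pow_reduce:
  shows "(La [^]\<^bsub>Q\<^esub> (n::nat)) (reduce t) = reduce ((left_A ^^ n) t)"
    and "(Lb [^]\<^bsub>Q\<^esub> (n::nat)) (reduce t) = reduce ((left_B ^^ n) t)"
    and "(Lc [^]\<^bsub>Q\<^esub> (n::nat)) (reduce t) = reduce ((left_C ^^ n) t)"
  by (simp_all add: pow_apply left_A_in_centralizer left_B_in_centralizer left_C_in_centralizer
      lift_funpow_reduce compatible_left_A compatible_left_B compatible_left_C)

lemma Q_eqI:
  "g \<in> carrier Q \<Longrightarrow> h \<in> carrier Q \<Longrightarrow> g (reduce (0, 0, 0)) = h (reduce (0, 0, 0)) \<Longrightarrow> g = h"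
  unfolding carrier_centralizer_group by (rule centralizer_eqI)

lemma Q_mult_reduce:
  "g \<in> carrier Q \<Longrightarrow> h \<in> carrier Q \<Longrightarrow> (g \<otimes>\<^bsub>Q\<^esub> h) (reduce t) = g (h (reduce t))"
  by (simp add: carrier_centralizer_group mult_apply)

lemmas left_reduce =
  lift_reduce[OF compatible_left_A] lift_reduce[OF compatible_left_B] lift_reduce[OF compatible_left_C]

lemma La_mult_Lb: "La \<otimes>\<^bsub>Q\<^esub> Lb = Lc \<otimes>\<^bsub>Q\<^esub> (Lb \<otimes>\<^bsub>Q\<^esub> La)"
proof (rule Q_eqI)
  show "(La \<otimes>\<^bsub>Q\<^esub> Lb) (reduce (0, 0, 0)) = (Lc \<otimes>\<^bsub>Q\<^esub> (Lb \<otimes>\<^bsub>Q\<^esub> La)) (reduce (0, 0, 0))"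
    by (simp add: Q_mult_reduce left_reduce)
qed simp_all

lemma La_mult_Lc: "La \<otimes>\<^bsub>Q\<^esub> Lc = Lc \<otimes>\<^bsub>Q\<^esub> La [^]\<^bsub>Q\<^esub> a"
proof (rule Q_eqI)
  show "(La \<otimes>\<^bsub>Q\<^esub> Lc) (reduce (0, 0, 0)) = (Lc \<otimes>\<^bsub>Q\<^esub> La [^]\<^bsub>Q\<^esub> a) (reduce (0, 0, 0))"
    by (simp add: Q_mult_reduce left_reduce left_pow_reduce left_A_funpow mult.commute)
qed simp_all

lemma Lc_mult_Lb: "Lc \<otimes>\<^bsub>Q\<^esub> Lb = Lb [^]\<^bsub>Q\<^esub> b \<otimes>\<^bsub>Q\<^esub> Lc"
proof (rule Q_eqI)
  show "(Lc \<otimes>\<^bsub>Q\<^esub> Lb) (reduce (0, 0, 0)) = (Lb [^]\<^bsub>Q\<^esub> b \<otimes>\<^bsub>Q\<^esub> Lc) (reduce (0, 0, 0))"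
    by (simp add: Q_mult_reduce left_reduce left_pow_reduce left_B_funpow)
qed simp_all

abbreviation "QA \<equiv> inv\<^bsub>Q\<^esub> La"
abbreviation "QB \<equiv> inv\<^bsub>Q\<^esub> Lb"

lemmas macdonald_of_lefts =
  Q.macdonald_of_inverses[OF La_closed Lb_closed Lc_closed La_mult_Lb La_mult_Lc Lc_mult_Lb]

lemma gcomm_QA_QB: "gcomm Q QA QB = Lc"
  by (rule macdonald_of_lefts(2))

sublocale QM: macdonald Q QA QB "int a" "int b"
  by (rule macdonald_of_lefts(1))

lemma Q_generated: "carrier Q = generate Q {QA, QB}" and order_Q: "order Q = 16 * q ^ 7"
proof -
  let ?H = "generate Q {QA, QB}"
  interpret H: subgroup ?H Q by (rule Q.generate_is_subgroup) simp
  have QAB: "QA \<in> ?H" "QB \<in> ?H" by (auto intro: generate.incl)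
  then have left: "La \<in> ?H" "Lb \<in> ?H" using H.m_inv_closed[of QA] H.m_inv_closed[of QB] by simp_all
  have "gcomm Q QA QB \<in> ?H" unfolding gcomm_def by (intro H.m_closed H.m_inv_closed QAB)
  then have Lc: "Lc \<in> ?H" by (simp only: gcomm_QA_QB)
  have pow: "g [^]\<^bsub>Q\<^esub> n \<in> ?H" if "g \<in> ?H" for g and n :: nat
    using Q.subgroup_int_pow_closed[OF H.subgroup_axioms \<open>g \<in> ?H\<close>, of "int n"] by (simp only: int_pow_int)
  have reach: "\<exists>h\<in>?H. h (reduce (0, 0, 0)) = x" if "x \<in> range reduce" for x
  proof -
    obtain i j k where x: "x = reduce (i, j, k)" using \<open>x \<in> range reduce\<close> by (metis imageE prod_cases3)
    let ?h = "Lb [^]\<^bsub>Q\<^esub> i \<otimes>\<^bsub>Q\<^esub> (Lc [^]\<^bsub>Q\<^esub> j \<otimes>\<^bsub>Q\<^esub> La [^]\<^bsub>Q\<^esub> (k * (N - 1)))"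
    have "?h (reduce (0, 0, 0)) = reduce (i, j, k * (N - 1) * (N - 1))"
      by (simp add: Q_mult_reduce left_pow_reduce left_A_funpow left_B_funpow left_C_funpow)
    then have "?h (reduce (0, 0, 0)) = x" by (simp only: reduce_negate_twice x)
    moreover have "?h \<in> ?H" by (intro H.m_closed pow left Lc)
    ultimately show ?thesis by blast
  qed
  have "{QA, QB} \<subseteq> centralizer" by (simp flip: carrier_centralizer_group)
  note generated = this reach
  show "carrier Q = ?H" by (rule carrier_eq_generate_if_transitive[OF generated])
  show "order Q = 16 * q ^ 7" unfolding card_range_reduce[symmetric]
    by (rule order_eq_card_if_transitive[OF generated])
qed

lemma ord_QA: "Q.ord QA = N"
proof -
  have "reduce (0, 0, n * (N - 1)) = reduce (0, 0, 0) \<longleftrightarrow> N dvd n" for n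
  proof -
    have "[int (n * (N - 1)) = 0] (mod int N) \<longleftrightarrow> [- int n = 0] (mod int N)"
      using cong_minus_mult[of 0 n] by (simp add: mult.commute) (metis cong_sym cong_trans)
    then show ?thesis by (simp add: reduce_eq_iff weight.simps cong_0_iff)
  qed
  then have "Q.ord La = N"
    by (intro ord_eqI left_A_in_centralizer)
      (simp add: lift_funpow_reduce compatible_left_A left_A_funpow)
  then show ?thesis by simp
qed

lemma ord_QB: "Q.ord QB = N"
proof -
  have "p dvd n" if "N dvd n" for n
    using p_dvd_N that by (simp only: int_dvd_int_iff) (rule dvd_trans)
  then have "reduce (n, 0, 0) = reduce (0, 0, 0) \<longleftrightarrow> N dvd n" for n
    by (auto simp: reduce_eq_iff weight.simps cong_0_iff)
  then have "Q.ord Lb = N"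
    by (intro ord_eqI left_B_in_centralizer)
      (simp add: lift_funpow_reduce compatible_left_B left_B_funpow)
  then show ?thesis by simp
qed

lemma ord_QC: "Q.ord (gcomm Q QA QB) = 4 * q\<^sup>2"
proof -
  have "reduce (0, n, 0) = reduce (0, 0, 0) \<longleftrightarrow> 4 * q\<^sup>2 dvd n" for n
  proof -
    have "N = q * (4 * q\<^sup>2)" by (simp add: N_def power2_eq_square power3_eq_cube)
    then have "N dvd q * n \<longleftrightarrow> 4 * q\<^sup>2 dvd n" using q_pos by simp
    moreover have "p dvd n" if "4 * q\<^sup>2 dvd n"
      using that by (auto simp: p_def)
    ultimately show ?thesis
      by (auto simp: reduce_eq_iff weight.simps cong_0_iff simp flip: of_nat_mult)
  qed
  then have "Q.ord Lc = 4 * q\<^sup>2"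
    by (intro ord_eqI left_C_in_centralizer)
      (simp add: lift_funpow_reduce compatible_left_C left_C_funpow)
  then show ?thesis by (simp only: gcomm_QA_QB)
qed

lemma QA_pow_eq_QB_pow: "QA [^]\<^bsub>Q\<^esub> int p = QB [^]\<^bsub>Q\<^esub> (- int p)"
proof -
  have "Lb [^]\<^bsub>Q\<^esub> p \<otimes>\<^bsub>Q\<^esub> La [^]\<^bsub>Q\<^esub> p = \<one>\<^bsub>Q\<^esub>"
  proof (rule Q_eqI)
    have "reduce (p, 0, p * (N - 1)) = reduce (0, 0, 0)"
      using cong_minus_mult[of p p]
      by (simp add: reduce_eq_iff weight.simps cong_0_iff mult.commute add.commute)
    then show "(Lb [^]\<^bsub>Q\<^esub> p \<otimes>\<^bsub>Q\<^esub> La [^]\<^bsub>Q\<^esub> p) (reduce (0, 0, 0)) = \<one>\<^bsub>Q\<^esub> (reduce (0, 0, 0))"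
      by (simp add: Q_mult_reduce left_pow_reduce left_A_funpow left_B_funpow one_apply)
  qed simp_all
  then have "Lb [^]\<^bsub>Q\<^esub> p = inv\<^bsub>Q\<^esub> (La [^]\<^bsub>Q\<^esub> p)"
    by (intro Q.inv_equality[symmetric]) simp_all
  then show ?thesis by (simp add: Q.nat_pow_inv Q.int_pow_neg int_pow_int)
qed

sublocale QC: central_macdonald Q QA QB "int a" "int b" q u v
proof
  show "QA [^]\<^bsub>Q\<^esub> (2 * (int q)\<^sup>2) \<otimes>\<^bsub>Q\<^esub> QB = QB \<otimes>\<^bsub>Q\<^esub> QA [^]\<^bsub>Q\<^esub> (2 * (int q)\<^sup>2)"
    unfolding int_p[symmetric] by (rule QM.A_pow_central_if_B_pow[OF QA_pow_eq_QB_pow])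
  have "QB [^]\<^bsub>Q\<^esub> int p = QA [^]\<^bsub>Q\<^esub> (- int p)"
    using QA_pow_eq_QB_pow by (simp add: Q.int_pow_neg)
  then show "QB [^]\<^bsub>Q\<^esub> (2 * (int q)\<^sup>2) \<otimes>\<^bsub>Q\<^esub> QA = QA \<otimes>\<^bsub>Q\<^esub> QB [^]\<^bsub>Q\<^esub> (2 * (int q)\<^sup>2)"
    unfolding int_p[symmetric] by (rule macdonald.A_pow_central_if_B_pow[OF QM.swap])
qed (rule Q_generated)

lemma nil_class_Q:
  assumes "even q"
  shows "nil_class Q (carrier Q) = 5"
proof -
  have "lcs Q (carrier Q) 4 \<noteq> {\<one>\<^bsub>Q\<^esub>}"
  proof
    assume "lcs Q (carrier Q) 4 = {\<one>\<^bsub>Q\<^esub>}"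
    moreover have a: "int (a - 1) = int a - 1"
      using \<alpha>.odd_x by (cases a) auto
    ultimately have "QA [^]\<^bsub>Q\<^esub> (1 - int a ^ (a - 1)) = \<one>\<^bsub>Q\<^esub>"
      using QM.A_pow_in_lcs_4[OF a] by simp
    then have "4 * int q ^ 3 dvd int a ^ (a - 1) - 1"
      using Q.int_pow_eq_id[of QA] ord_QA by (simp add: int_N dvd_diff_commute)
    then show False using \<alpha>.power_minus_one_not_dvd[OF _ a] assms by simp
  qed
  then have "nil_class Q (carrier Q) = Suc 4"
    using QC.lcs_5_trivial by (intro Q.nil_class_eqI Q.subgroup_self) simp_all
  then show ?thesis by simp
qed

end

subsection \<open>The presented group\<close>

lemma pclass_eq_iff: "pclass \<alpha> \<beta> u = pclass \<alpha> \<beta> v \<longleftrightarrow> peq \<alpha> \<beta> u v"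
  unfolding pclass_def using peq.refl peq.sym peq.trans by blast

lemma peq_append:
  assumes "peq \<alpha> \<beta> u u'" "peq \<alpha> \<beta> v v'"
  shows "peq \<alpha> \<beta> (u @ v) (u' @ v')"
proof -
  have "peq \<alpha> \<beta> (u @ v) (u' @ v)" using peq.cong[OF assms(1), of "[]" v] by simp
  moreover have "peq \<alpha> \<beta> (u' @ v) (u' @ v')" using peq.cong[OF assms(2), of u' "[]"] by simp
  ultimately show ?thesis by (rule peq.trans)
qed

lemma Gpres_mult: "pclass \<alpha> \<beta> u \<otimes>\<^bsub>Gpres \<alpha> \<beta>\<^esub> pclass \<alpha> \<beta> v = pclass \<alpha> \<beta> (u @ v)"
proof -
  have "peq \<alpha> \<beta> (x @ y) w \<Longrightarrow> peq \<alpha> \<beta> u x \<Longrightarrow> peq \<alpha> \<beta> v y \<Longrightarrow> peq \<alpha> \<beta> (u @ v) w" for x y w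
    using peq_append peq.trans by blast
  then show ?thesis unfolding Gpres_def pclass_def by (auto intro: peq.refl)
qed

lemma Gpres_one: "\<one>\<^bsub>Gpres \<alpha> \<beta>\<^esub> = pclass \<alpha> \<beta> []"
  and Gpres_carrier: "carrier (Gpres \<alpha> \<beta>) = range (pclass \<alpha> \<beta>)"
  by (simp_all add: Gpres_def)

lemma pclass_closed [simp]: "pclass \<alpha> \<beta> w \<in> carrier (Gpres \<alpha> \<beta>)"
  by (simp add: Gpres_carrier)

definition word_inverse :: "gword \<Rightarrow> gword" where
  "word_inverse w = rev (map (\<lambda>x. (fst x, \<not> snd x)) w)"

lemma peq_word_inverse: "peq \<alpha> \<beta> (word_inverse w @ w) []"
proof (induction w)
  case Nil
  then show ?case by (simp add: word_inverse_def peq.refl)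
next
  case (Cons x w)
  have "peq \<alpha> \<beta> [(fst x, \<not> snd x), x] []" using peq.cancel[of \<alpha> \<beta> "(fst x, \<not> snd x)"] by simp
  then have "peq \<alpha> \<beta> (word_inverse w @ [(fst x, \<not> snd x), x] @ w) (word_inverse w @ [] @ w)"
    by (rule peq.cong)
  then have "peq \<alpha> \<beta> (word_inverse (x # w) @ x # w) (word_inverse w @ w)" by (simp add: word_inverse_def)
  then show ?case using Cons by (rule peq.trans)
qed

lemma group_Gpres: "group (Gpres \<alpha> \<beta>)"
proof (rule groupI)
  fix x assume "x \<in> carrier (Gpres \<alpha> \<beta>)"
  then obtain w where x: "x = pclass \<alpha> \<beta> w" by (auto simp: Gpres_carrier)
  show "\<exists>y\<in>carrier (Gpres \<alpha> \<beta>). y \<otimes>\<^bsub>Gpres \<alpha> \<beta>\<^esub> x = \<one>\<^bsub>Gpres \<alpha> \<beta>\<^esub>"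
    by (rule bexI[of _ "pclass \<alpha> \<beta> (word_inverse w)"])
      (simp_all add: x Gpres_mult Gpres_one pclass_eq_iff peq_word_inverse)
qed (auto simp: Gpres_carrier Gpres_mult Gpres_one)

lemma Gpres_inv: "inv\<^bsub>Gpres \<alpha> \<beta>\<^esub> pclass \<alpha> \<beta> w = pclass \<alpha> \<beta> (word_inverse w)"
  by (rule group.inv_equality[OF group_Gpres])
    (simp_all add: Gpres_mult Gpres_one pclass_eq_iff peq_word_inverse)

lemma concat_replicate_commute: "concat (replicate n w) @ w = w @ concat (replicate n w)"
  by (induction n) simp_all

lemma Gpres_pow: "pclass \<alpha> \<beta> w [^]\<^bsub>Gpres \<alpha> \<beta>\<^esub> (n::nat) = pclass \<alpha> \<beta> (concat (replicate n w))"
proof -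
  interpret group "Gpres \<alpha> \<beta>" by (rule group_Gpres)
  show ?thesis
    by (induction n) (simp_all add: Gpres_one Gpres_mult concat_replicate_commute)
qed

lemma Gpres_wpow: "pclass \<alpha> \<beta> (wpow w (word_inverse w) k) = pclass \<alpha> \<beta> w [^]\<^bsub>Gpres \<alpha> \<beta>\<^esub> (k::int)"
proof -
  interpret group "Gpres \<alpha> \<beta>" by (rule group_Gpres)
  have "pclass \<alpha> \<beta> (concat (replicate n (word_inverse w)))
      = inv\<^bsub>Gpres \<alpha> \<beta>\<^esub> (pclass \<alpha> \<beta> w [^]\<^bsub>Gpres \<alpha> \<beta>\<^esub> n)" for n
    by (simp only: Gpres_pow[symmetric] Gpres_inv[symmetric] nat_pow_inv pclass_closed)
  then show ?thesis by (simp add: wpow_def int_pow_def2 Gpres_pow)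
qed

lemma word_inverse_generators:
  "word_inverse wA = wAi" "word_inverse wB = wBi" "word_inverse wC = wCi"
  by (simp_all add: word_inverse_def wA_def wAi_def wB_def wBi_def wC_def wCi_def)

lemma gcomm_Gpres: "gcomm (Gpres \<alpha> \<beta>) (pclass \<alpha> \<beta> wA) (pclass \<alpha> \<beta> wB) = pclass \<alpha> \<beta> wC"
  by (simp add: gcomm_def Gpres_inv Gpres_mult word_inverse_generators wC_def)

lemma macdonald_Gpres: "macdonald (Gpres \<alpha> \<beta>) (pclass \<alpha> \<beta> wA) (pclass \<alpha> \<beta> wB) \<alpha> \<beta>"
proof -
  interpret group "Gpres \<alpha> \<beta>" by (rule group_Gpres)
  show ?thesis
    using peq.rel1[of \<alpha> \<beta>] peq.rel2[of \<alpha> \<beta>] Gpres_wpow[of \<alpha> \<beta> wA] Gpres_wpow[of \<alpha> \<beta> wB]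
    by unfold_locales (simp_all add: gcomm_Gpres Gpres_inv Gpres_mult word_inverse_generators
        flip: pclass_eq_iff)
qed

lemma Gpres_generated:
  "carrier (Gpres \<alpha> \<beta>) = generate (Gpres \<alpha> \<beta>) {pclass \<alpha> \<beta> wA, pclass \<alpha> \<beta> wB}" (is "_ = ?H")
proof
  interpret group "Gpres \<alpha> \<beta>" by (rule group_Gpres)
  interpret H: subgroup ?H "Gpres \<alpha> \<beta>" by (rule generate_is_subgroup) simp
  show "?H \<subseteq> carrier (Gpres \<alpha> \<beta>)" by (rule H.subset)
  have gens: "pclass \<alpha> \<beta> wA \<in> ?H" "pclass \<alpha> \<beta> wB \<in> ?H" by (auto intro: generate.incl)
  have invs: "pclass \<alpha> \<beta> wAi \<in> ?H" "pclass \<alpha> \<beta> wBi \<in> ?H"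
    using H.m_inv_closed[OF gens(1)] H.m_inv_closed[OF gens(2)]
    by (simp_all only: Gpres_inv word_inverse_generators)
  have "pclass \<alpha> \<beta> w \<in> ?H" for w
  proof (induction w)
    case Nil
    then show ?case using H.one_closed by (simp only: Gpres_one)
  next
    case (Cons x w)
    have "[x] \<in> {wA, wAi, wB, wBi}" by (cases x) (auto simp: wA_def wAi_def wB_def wBi_def)
    then have "pclass \<alpha> \<beta> [x] \<in> ?H" using gens invs by auto
    then have "pclass \<alpha> \<beta> [x] \<otimes>\<^bsub>Gpres \<alpha> \<beta>\<^esub> pclass \<alpha> \<beta> w \<in> ?H" using Cons by (rule H.m_closed)
    then show ?case by (simp add: Gpres_mult)
  qed
  then show "carrier (Gpres \<alpha> \<beta>) \<subseteq> ?H" by (auto simp: Gpres_carrier)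
qed

context macdonald
begin

fun letter :: "bool \<times> bool \<Rightarrow> 'a" where
  "letter (g, inverted) = (let x = if g then B else A in if inverted then inv x else x)"

fun eval_word :: "gword \<Rightarrow> 'a" where
  "eval_word [] = \<one>"
| "eval_word (x # w) = letter x \<otimes> eval_word w"

lemma letter_closed [simp]: "letter x \<in> carrier G"
  by (cases x) (simp add: Let_def)

lemma eval_word_closed [simp]: "eval_word w \<in> carrier G"
  by (induction w) simp_all

lemma eval_word_append: "eval_word (u @ v) = eval_word u \<otimes> eval_word v"
  by (induction u) (simp_all add: m_assoc)

lemma eval_word_concat_replicate: "eval_word (concat (replicate n w)) = eval_word w [^] n"
proof (induction n)
  case (Suc n)
  have "concat (replicate (Suc n) w) = concat (replicate n w) @ w" by (simp add: concat_replicate_commute)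
  then show ?case using Suc by (simp only: eval_word_append nat_pow_Suc)
qed simp

lemma eval_word_generators:
  "eval_word wA = A" "eval_word wAi = inv A" "eval_word wB = B" "eval_word wBi = inv B"
  "eval_word wC = C" "eval_word wCi = inv C"
  by (simp_all add: wA_def wAi_def wB_def wBi_def wC_def wCi_def gcomm_def inv_mult_group m_assoc)

lemma eval_word_wpow:
  assumes "eval_word w' = inv (eval_word w)"
  shows "eval_word (wpow w w' k) = eval_word w [^] k"
proof (cases k rule: int_cases)
  case (nonneg n)
  then show ?thesis by (simp add: wpow_def eval_word_concat_replicate int_pow_int)
next
  case (neg n)
  have "wpow w w' k = concat (replicate (Suc n) w')" by (simp add: wpow_def neg nat_add_distrib)
  then have "eval_word (wpow w w' k) = inv (eval_word w) [^] Suc n"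
    by (simp only: eval_word_concat_replicate assms)
  then show ?thesis by (simp only: neg int_pow_neg int_pow_int nat_pow_inv eval_word_closed)
qed

lemma eval_word_peq: "peq \<alpha> \<beta> u v \<Longrightarrow> eval_word u = eval_word v"
proof (induction rule: peq.induct)
  case (cancel x)
  then show ?case by (cases x) (simp add: Let_def)
next
  case rel1
  then show ?case using rel_A
    by (simp add: eval_word_append eval_word_generators eval_word_wpow m_assoc)
next
  case rel2
  then show ?case using rel_B
    by (simp add: eval_word_append eval_word_generators eval_word_wpow m_assoc)
next
  case (cong u v p q)
  then show ?case by (simp add: eval_word_append)
qed simp_all

definition presentation_hom :: "gword set \<Rightarrow> 'a" where
  "presentation_hom S = eval_word (SOME w. w \<in> S)"

lemma presentation_hom_pclass: "presentation_hom (pclass \<alpha> \<beta> w) = eval_word w"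
proof -
  have "(SOME v. v \<in> pclass \<alpha> \<beta> w) \<in> pclass \<alpha> \<beta> w"
    by (rule someI[of _ w]) (simp add: pclass_def peq.refl)
  then have "peq \<alpha> \<beta> w (SOME v. v \<in> pclass \<alpha> \<beta> w)" by (simp add: pclass_def)
  then show ?thesis using eval_word_peq by (simp add: presentation_hom_def)
qed

lemma presentation_hom_generators:
  "presentation_hom (pclass \<alpha> \<beta> wA) = A" "presentation_hom (pclass \<alpha> \<beta> wB) = B"
  "presentation_hom (pclass \<alpha> \<beta> wC) = C"
  by (simp_all only: presentation_hom_pclass eval_word_generators)

lemma group_hom_presentation: "group_hom (Gpres \<alpha> \<beta>) G presentation_hom"
proof -
  have "presentation_hom \<in> hom (Gpres \<alpha> \<beta>) G"
    by (rule homI) (auto simp: Gpres_carrier presentation_hom_pclass Gpres_mult eval_word_append)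
  then show ?thesis using group_Gpres is_group by (simp add: group_hom_def group_hom_axioms_def)
qed

lemma presentation_hom_surj:
  assumes "carrier G = generate G {A, B}"
  shows "presentation_hom ` carrier (Gpres \<alpha> \<beta>) = carrier G"
proof -
  interpret h: group_hom "Gpres \<alpha> \<beta>" G presentation_hom by (rule group_hom_presentation)
  have "generate G (presentation_hom ` {pclass \<alpha> \<beta> wA, pclass \<alpha> \<beta> wB})
      = presentation_hom ` generate (Gpres \<alpha> \<beta>) {pclass \<alpha> \<beta> wA, pclass \<alpha> \<beta> wB}"
    by (rule h.generate_img) simp
  then have "presentation_hom ` carrier (Gpres \<alpha> \<beta>)
      = generate G (presentation_hom ` {pclass \<alpha> \<beta> wA, pclass \<alpha> \<beta> wB})"
    by (simp only: Gpres_generated)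
  then show ?thesis by (simp only: image_insert image_empty presentation_hom_generators assms)
qed

end

subsection \<open>Homomorphisms onto 2-groups with kernel of odd order\<close>

lemma (in group) ord_two_part:
  assumes "finite (carrier G)" and x: "x \<in> carrier G"
  shows "ord (two_part G x) = 2 ^ multiplicity 2 (ord x)"
proof -
  define k where "k = multiplicity 2 (ord x)"
  define r where "r = ord x div 2 ^ k"
  define e where "e = (SOME e::nat. [e = 1] (mod 2 ^ k) \<and> [e = 0] (mod r))"
  have "ord x > 0" using ord_ge_1[OF assms] by simp
  then have "odd r" using multiplicity_decompose[of "ord x" 2] by (simp add: r_def k_def)
  then have "\<exists>e::nat. [e = 1] (mod 2 ^ k) \<and> [e = 0] (mod r)"
    by (intro binary_chinese_remainder_nat) simp
  then have e: "[e = 1] (mod 2 ^ k)" "[e = 0] (mod r)"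
    unfolding e_def by (metis (mono_tags, lifting) someI_ex)+
  have ord: "ord x = r * 2 ^ k" by (simp add: r_def k_def multiplicity_dvd)
  obtain f where f: "e = r * f" using e(2) by (auto simp: cong_0_iff)
  have "coprime e (2 ^ k)" using e(1) by (metis cong_imp_coprime cong_sym coprime_1_left)
  then have "coprime (2 ^ k) f" by (metis coprime_commute coprime_mult_left_iff f)
  have pow: "(x [^] e) [^] n = \<one> \<longleftrightarrow> 2 ^ k dvd n" for n :: nat
  proof -
    have "(x [^] e) [^] n = \<one> \<longleftrightarrow> r * 2 ^ k dvd r * (f * n)"
      using x by (simp add: nat_pow_pow pow_eq_id ord f mult.assoc)
    also have "\<dots> \<longleftrightarrow> 2 ^ k dvd f * n" using \<open>odd r\<close> by auto
    also have "\<dots> \<longleftrightarrow> 2 ^ k dvd n" using \<open>coprime (2 ^ k) f\<close> by (rule coprime_dvd_mult_right_iff)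
    finally show ?thesis .
  qed
  have "two_part G x = x [^] e" by (simp add: two_part_def Let_def e_def r_def k_def)
  moreover have "ord (x [^] e) = 2 ^ k" using x pow by (subst ord_unique) simp_all
  ultimately show ?thesis by (simp only: k_def)
qed

locale odd_kernel_hom = group_hom +
  fixes e :: nat
  assumes finite_G: "finite (carrier G)" and surj: "h ` carrier G = carrier H"
    and order_H: "order H = 2 ^ e" and order_G: "\<exists>c. odd c \<and> order G dvd 2 ^ e * c"
begin

lemma odd_kernel: "odd (card (kernel G H h))"
  and order_eq: "order G = 2 ^ e * card (kernel G H h)"
proof -
  have "(\<lambda>U. the_elem (h ` U)) \<in> iso (G Mod kernel G H h) H"
    using FactGroup_iso_set[OF surj] .
  then have "card (rcosets kernel G H h) = card (carrier H)"
    by (auto simp: iso_def FactGroup_def dest: bij_betw_same_card)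
  then show order: "order G = 2 ^ e * card (kernel G H h)"
    using G.lagrange[OF subgroup_kernel] order_H by (simp add: order_def)
  obtain c where c: "odd c" "order G dvd 2 ^ e * c" using order_G by blast
  then have "card (kernel G H h) dvd c" by (simp add: order)
  then show "odd (card (kernel G H h))" using c(1) dvd_trans by blast
qed

lemma multiplicity_order: "multiplicity 2 (order G) = e"
  unfolding order_eq using odd_kernel
  by (simp add: prime_elem_multiplicity_mult_distrib not_dvd_imp_multiplicity_0 odd_pos)

lemma pow_card_kernel:
  assumes "x \<in> carrier G" "h x = \<one>\<^bsub>H\<^esub>"
  shows "x [^]\<^bsub>G\<^esub> card (kernel G H h) = \<one>\<^bsub>G\<^esub>"
  using assms by (intro G.pow_card_subgroup subgroup_kernel) (simp add: kernel_def)

lemma ord_two_part_eq: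
  assumes x: "x \<in> carrier G" and r: "group.ord H (h x) = 2 ^ r"
  shows "G.ord (two_part G x) = 2 ^ r"
proof -
  have "h x [^]\<^bsub>H\<^esub> G.ord x = \<one>\<^bsub>H\<^esub>" using x by (simp flip: hom_nat_pow)
  then have "2 ^ r dvd G.ord x" using x r H.pow_eq_id[of "h x"] by simp
  then obtain s where s: "G.ord x = 2 ^ r * s" by blast
  have "h (x [^]\<^bsub>G\<^esub> (2 ^ r :: nat)) = \<one>\<^bsub>H\<^esub>"
    using x H.pow_ord_eq_1[of "h x"] r by (simp add: hom_nat_pow)
  then have "x [^]\<^bsub>G\<^esub> (2 ^ r * card (kernel G H h)) = \<one>\<^bsub>G\<^esub>"
    using x pow_card_kernel[of "x [^]\<^bsub>G\<^esub> (2 ^ r :: nat)"] by (simp add: G.nat_pow_pow)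
  then have "s dvd card (kernel G H h)" using x s by (simp add: G.pow_eq_id)
  then have "odd s" using odd_kernel dvd_trans by blast
  then have "multiplicity 2 (G.ord x) = r"
    by (simp add: s prime_elem_multiplicity_mult_distrib not_dvd_imp_multiplicity_0 odd_pos)
  then show ?thesis using G.ord_two_part[OF finite_G x] by simp
qed

lemma sylow2_isomorphic:
  assumes "sylow2 G P"
  shows "card P = 2 ^ e" "inj_on h P" "h ` P = carrier H"
proof -
  have P: "subgroup P G" and card_P: "card P = 2 ^ e"
    using assms by (simp_all add: sylow2_def multiplicity_order)
  interpret P: subgroup P G by (rule P)
  have trivial: "x = \<one>\<^bsub>G\<^esub>" if x: "x \<in> P" "h x = \<one>\<^bsub>H\<^esub>" for x
  proof -
    have "G.ord x dvd card (kernel G H h)" "G.ord x dvd 2 ^ e"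
      using x pow_card_kernel G.pow_card_subgroup[OF P x(1)] by (simp_all add: card_P flip: G.pow_eq_id)
    moreover have "coprime (card (kernel G H h)) (2 ^ e)" using odd_kernel by simp
    ultimately have "G.ord x = 1" by (metis coprime_common_divisor_nat)
    then show ?thesis using G.ord_eq_1 x by simp
  qed
  show inj: "inj_on h P"
  proof (rule inj_onI)
    fix x y assume xy: "x \<in> P" "y \<in> P" "h x = h y"
    then have "x \<otimes>\<^bsub>G\<^esub> inv\<^bsub>G\<^esub> y = \<one>\<^bsub>G\<^esub>" by (intro trivial) simp_all
    then show "x = y" using xy by (metis G.inv_closed G.inv_equality G.inv_inv P.mem_carrier)
  qed
  have "card (h ` P) = card (carrier H)"
    using card_P order_H inj by (simp add: card_image order_def)
  moreover have "finite (carrier H)" using finite_G by (simp flip: surj)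
  moreover have "h ` P \<subseteq> carrier H" by auto
  ultimately show "h ` P = carrier H" by (simp add: card_subset_eq)
  show "card P = 2 ^ e" by (rule card_P)
qed

end

subsection \<open>The Sylow 2-subgroup\<close>

lemma dyadic_unit_if_multiplicity:
  fixes x :: int
  assumes "x \<noteq> 1" "multiplicity 2 (x - 1) = m" "m > 1"
  shows "\<exists>w. dyadic_unit (int (2 ^ (m - 1))) x w"
proof -
  obtain w where w: "x - 1 = 2 ^ m * w" "odd w"
    using multiplicity_decompose'[of "x - 1" 2] assms(1,2) by auto
  have "x = 1 + 2 * 2 ^ (m - 1) * w" using w(1) assms(3) by (simp flip: power_Suc)
  moreover have "coprime 3 ((2::int) ^ (m - 1))" by simp
  ultimately have "dyadic_unit (int (2 ^ (m - 1))) x w"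
    using w(2) by unfold_locales simp_all
  then show ?thesis by blast
qed

context dyadic_unit
begin

lemma abs_gt_one:
  assumes "even q" "x \<noteq> 1"
  shows "\<bar>x\<bar> > 1"
proof -
  have "4 dvd x - 1" using assms(1) by (auto simp: x_eq)
  then show ?thesis using assms(2) by presburger
qed

lemma dyadic_unit_if_cong:
  assumes "[y = x] (mod 4 * q\<^sup>2)"
  obtains w' where "dyadic_unit q y w'"
proof -
  obtain k where "y - x = 4 * q\<^sup>2 * k" using assms by (auto simp: cong_iff_dvd_diff)
  then have "y = 1 + 2 * q * (w + 2 * (q * k))" by (simp add: x_eq algebra_simps power2_eq_square)
  then have "dyadic_unit q y (w + 2 * (q * k))"
    using coprime_3_q odd_w by unfold_locales simp_all
  then show thesis by (rule that)
qed

end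

lemma (in dyadic_unit_pair) nat_representatives:
  assumes "l > 0" "4 * q\<^sup>2 dvd int l"
  obtains a b u' v' where "dyadic_unit_pair q (int a) (int b) u' v'" "b \<le> a"
    "[int a = \<alpha>] (mod int l)" "[int b = \<beta>] (mod int l)"
proof -
  define a b where "a = nat (\<alpha> mod int l) + l" and "b = nat (\<beta> mod int l)"
  have a: "[int a = \<alpha>] (mod int l)" and b: "[int b = \<beta>] (mod int l)"
    using assms(1) by (simp_all add: a_def b_def cong_def)
  have "\<beta> mod int l < int l" using assms(1) by simp
  then have "b \<le> a" by (simp add: a_def b_def)
  have a': "[int a = \<alpha>] (mod 4 * q\<^sup>2)" and b': "[int b = \<beta>] (mod 4 * q\<^sup>2)"
    using a b assms(2) by (blast intro: cong_dvd_modulus)+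
  then have "[int a = int b] (mod 4 * q\<^sup>2)"
    using \<alpha>_cong_\<beta> by (meson cong_sym cong_trans)
  moreover obtain u' where "dyadic_unit q (int a) u'" using \<alpha>.dyadic_unit_if_cong[OF a'] .
  moreover obtain v' where "dyadic_unit q (int b) v'" using \<beta>.dyadic_unit_if_cong[OF b'] .
  ultimately have "dyadic_unit_pair q (int a) (int b) u' v'"
    by (simp add: dyadic_unit_pair_def dyadic_unit_pair_axioms_def)
  then show thesis using \<open>b \<le> a\<close> a b by (rule that)
qed

lemma (in macdonald) macdonald_if_cong_exponents:
  assumes "[\<alpha>' = \<alpha>] (mod int (ord A))" "[\<beta>' = \<beta>] (mod int (ord B))"
  shows "macdonald G A B \<alpha>' \<beta>'"
proof -
  have "A [^] \<alpha> = A [^] \<alpha>'" "B [^] \<beta> = B [^] \<beta>'"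
    using assms by (simp_all add: int_pow_eq cong_iff_dvd_diff)
  then show ?thesis using rel_A rel_B by unfold_locales simp_all
qed

lemma (in torsion_macdonald) order_dvd_odd_multiple_if_dyadic:
  fixes q :: nat
  assumes "dyadic_unit_pair (int q) \<alpha> \<beta> u v"
  shows "\<exists>c. odd c \<and> order G dvd 16 * q ^ 7 * c"
proof -
  interpret dyadic_unit_pair "int q" \<alpha> \<beta> u v by fact
  define l where "l = ord A * (ord B * (4 * q\<^sup>2))"
  have "l > 0" "4 * (int q)\<^sup>2 dvd int l"
    using ord_A ord_B \<alpha>.q_nonzero by (simp_all add: l_def)
  then obtain a b u' v' where pair: "dyadic_unit_pair (int q) (int a) (int b) u' v'" and "b \<le> a"
    and a: "[int a = \<alpha>] (mod int l)" and b: "[int b = \<beta>] (mod int l)"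
    by (rule nat_representatives)
  have "macdonald G A B (int a) (int b)"
  proof (rule macdonald_if_cong_exponents)
    show "[int a = \<alpha>] (mod int (ord A))" using a by (rule cong_dvd_modulus) (simp add: l_def)
    show "[int b = \<beta>] (mod int (ord B))" using b by (rule cong_dvd_modulus) (simp add: l_def)
  qed
  then interpret rep: torsion_macdonald G A B "int a" "int b"
    by (intro torsion_macdonald.intro torsion_macdonald_axioms.intro generated ord_A ord_B)
  obtain c where "odd c" "int (order G) dvd 16 * int q ^ 7 * c"
    using rep.order_dvd_odd_multiple_if_nonneg[OF pair] \<open>b \<le> a\<close> by auto
  moreover have "int (16 * q ^ 7 * nat \<bar>c\<bar>) = \<bar>16 * int q ^ 7 * c\<bar>" by (simp add: abs_mult)
  ultimately have "order G dvd 16 * q ^ 7 * nat \<bar>c\<bar>"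
    by (simp only: dvd_abs_iff flip: int_dvd_int_iff)
  moreover have "odd (nat \<bar>c\<bar>)" using \<open>odd c\<close> by (simp add: even_nat_iff)
  ultimately show ?thesis by blast
qed

lemma torsion_macdonald_Gpres:
  assumes "odd \<alpha>" "odd \<beta>" "\<bar>\<alpha>\<bar> > 1" "\<bar>\<beta>\<bar> > 1"
  shows "torsion_macdonald (Gpres \<alpha> \<beta>) (pclass \<alpha> \<beta> wA) (pclass \<alpha> \<beta> wB) \<alpha> \<beta>"
  by (intro torsion_macdonald.intro torsion_macdonald_axioms.intro macdonald_Gpres Gpres_generated
      macdonald.ord_nonzero[OF macdonald_Gpres assms])

lemma two_quotient_exists:
  fixes q :: nat
  assumes pair: "dyadic_unit_pair (int q) \<alpha> \<beta> u v" and "even q" "\<alpha> \<noteq> 1" "\<beta> \<noteq> 1"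
    and e: "16 * q ^ 7 = 2 ^ e"
  obtains H :: "(nat \<times> nat \<times> nat \<Rightarrow> nat \<times> nat \<times> nat) monoid" and h
  where "odd_kernel_hom (Gpres \<alpha> \<beta>) H h e" "nil_class H (carrier H) = 5"
    "group.ord H (h (pclass \<alpha> \<beta> wA)) = 4 * q ^ 3" "group.ord H (h (pclass \<alpha> \<beta> wB)) = 4 * q ^ 3"
    "group.ord H (h (pclass \<alpha> \<beta> wC)) = 4 * q\<^sup>2"
proof -
  interpret dyadic_unit_pair "int q" \<alpha> \<beta> u v by fact
  interpret G: torsion_macdonald "Gpres \<alpha> \<beta>" "pclass \<alpha> \<beta> wA" "pclass \<alpha> \<beta> wB" \<alpha> \<beta>
    using assms by (intro torsion_macdonald_Gpres \<alpha>.odd_x \<beta>.odd_x \<alpha>.abs_gt_one \<beta>.abs_gt_one) simp_all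
  obtain a b u' v' where "dyadic_unit_pair (int q) (int a) (int b) u' v'"
    and ab: "[int a = \<alpha>] (mod int (4 * q ^ 3))" "[int b = \<beta>] (mod int (4 * q ^ 3))"
  proof (rule nat_representatives)
    show "4 * q ^ 3 > 0" using \<alpha>.q_nonzero by simp
    show "4 * (int q)\<^sup>2 dvd int (4 * q ^ 3)" by (simp add: le_imp_power_dvd)
  qed
  then interpret M: macdonald_model q a b u' v' by (intro macdonald_model.intro)
  interpret Q: macdonald M.Q M.QA M.QB \<alpha> \<beta>
    using ab
    by (intro M.QM.macdonald_if_cong_exponents) (simp_all add: M.ord_QA M.ord_QB M.N_def cong_sym_eq)
  have "odd_kernel_hom (Gpres \<alpha> \<beta>) M.Q Q.presentation_hom e"
    using G.order_dvd_odd_multiple_if_dyadic[OF pair] M.order_Q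
    by (intro odd_kernel_hom.intro odd_kernel_hom_axioms.intro Q.group_hom_presentation
        G.finite_carrier Q.presentation_hom_surj M.Q_generated) (simp_all only: e)
  then show thesis
    using M.nil_class_Q M.ord_QA M.ord_QB M.ord_QC \<open>even q\<close>
    by (intro that[of M.Q Q.presentation_hom]) (simp_all only: Q.presentation_hom_generators M.N_def)
qed

lemma powers_of_two_power:
  fixes m :: nat
  assumes "m > 1"
  shows "16 * (2 ^ (m - 1)) ^ 7 = (2::nat) ^ (7 * m - 3)" "4 * (2 ^ (m - 1)) ^ 3 = (2::nat) ^ (3 * m - 1)"
    "4 * (2 ^ (m - 1))\<^sup>2 = (2::nat) ^ (2 * m)" "even ((2::nat) ^ (m - 1))"
    "4 * (int (2 ^ (m - 1)))\<^sup>2 = 2 ^ (2 * m)"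
proof -
  obtain k where "m = Suc k" "k > 0" using assms by (cases m) auto
  then show "16 * (2 ^ (m - 1)) ^ 7 = (2::nat) ^ (7 * m - 3)" "4 * (2 ^ (m - 1)) ^ 3 = (2::nat) ^ (3 * m - 1)"
    "4 * (2 ^ (m - 1))\<^sup>2 = (2::nat) ^ (2 * m)" "even ((2::nat) ^ (m - 1))"
    "4 * (int (2 ^ (m - 1)))\<^sup>2 = 2 ^ (2 * m)"
    by (simp_all add: power_add mult.commute flip: power_mult)
qed

theorem theorem15p1:
  fixes \<alpha> \<beta> :: int and m :: nat and P :: "gword set set"
  assumes "\<alpha> \<noteq> 1" and "\<beta> \<noteq> 1"
    and "multiplicity 2 (\<alpha> - 1) = m" and "multiplicity 2 (\<beta> - 1) = m" and "m > 1"
    and "\<alpha> = \<beta> \<or> 2 * m \<le> multiplicity 2 (\<alpha> - \<beta>)"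
    and "sylow2 (Gpres \<alpha> \<beta>) P"
  shows "card P = 2 ^ (7 * m - 3)
    \<and> nil_class (Gpres \<alpha> \<beta>) P = 5
    \<and> group.ord (Gpres \<alpha> \<beta>) (two_part (Gpres \<alpha> \<beta>) (pclass \<alpha> \<beta> wA)) = 2 ^ (3 * m - 1)
    \<and> group.ord (Gpres \<alpha> \<beta>) (two_part (Gpres \<alpha> \<beta>) (pclass \<alpha> \<beta> wB)) = 2 ^ (3 * m - 1)
    \<and> group.ord (Gpres \<alpha> \<beta>) (two_part (Gpres \<alpha> \<beta>) (pclass \<alpha> \<beta> wC)) = 2 ^ (2 * m)"
proof -
  define q :: nat where "q = 2 ^ (m - 1)"
  note powers = powers_of_two_power[OF \<open>m > 1\<close>, folded q_def]
  obtain u v where "dyadic_unit (int q) \<alpha> u" "dyadic_unit (int q) \<beta> v"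
    using dyadic_unit_if_multiplicity[OF assms(1,3,5)] dyadic_unit_if_multiplicity[OF assms(2,4,5)]
    unfolding q_def by blast
  moreover have "[\<alpha> = \<beta>] (mod 4 * (int q)\<^sup>2)"
    using assms(6) multiplicity_dvd'[of "2 * m" 2 "\<alpha> - \<beta>"] by (auto simp: powers(5) cong_iff_dvd_diff)
  ultimately have "dyadic_unit_pair (int q) \<alpha> \<beta> u v"
    by (simp add: dyadic_unit_pair_def dyadic_unit_pair_axioms_def)
  then obtain H :: "(nat \<times> nat \<times> nat \<Rightarrow> nat \<times> nat \<times> nat) monoid" and h
    where h: "odd_kernel_hom (Gpres \<alpha> \<beta>) H h (7 * m - 3)" and H: "nil_class H (carrier H) = 5"
    and ord: "group.ord H (h (pclass \<alpha> \<beta> wA)) = 2 ^ (3 * m - 1)"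
      "group.ord H (h (pclass \<alpha> \<beta> wB)) = 2 ^ (3 * m - 1)" "group.ord H (h (pclass \<alpha> \<beta> wC)) = 2 ^ (2 * m)"
    using two_quotient_exists[OF _ \<open>even q\<close> assms(1,2) powers(1)] unfolding powers by blast
  interpret odd_kernel_hom "Gpres \<alpha> \<beta>" H h "7 * m - 3" by (rule h)
  note P = sylow2_isomorphic[OF assms(7)]
  have "nil_class (Gpres \<alpha> \<beta>) P = 5"
    using nil_class_image[OF _ P(2)] assms(7) by (simp add: P(3) H sylow2_def)
  then show ?thesis using P(1) ord by (simp add: ord_two_part_eq)
qed

end
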